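(* Let $\bar t>0$, $C>0$, $a_*>0$ be constants. There is a constant $c>0$ depending only on $\bar t, C, a_*$ (in particular independent of $n$) such that the following holds for all $n\ge 2$, $k\ge 1$. Let $|\Psi\rangle=\sum_{\vec s\in\{\pm1\}^n}\Psi(\vec s)|\vec s\rangle$ be a normalized feed-forward neural quantum state on $n$ qubits with $k$ scalar nonlinearities, written as $$\Psi(\vec s)=\mathcal G(t_1(\vec s),\ldots,t_\mu(\vec s)),\qquad 1\le \mu\le k+1,$$ where $\mathcal G:\mathbb R^\mu\to\mathbb C$ and $t_i(\vec s)=\vec w_i^T\vec s+b_i$ with $\vec w_i\in\mathbb R^n$, $b_i\in\mathbb R$. Suppose $\sup_{\vec s,i}|\vec w_i^T\vec s+b_i|<\bar t$. Suppose the function $g(x_1,\ldots,x_\mu)=\mathcal G(\bar t x_1,\ldots,\bar t x_\mu)$ on $[-1,1]^\mu$ admits an analytic extension $g(z_1,\ldots,z_\mu)$ to a product of Bernstein ellipses $\mathcal B=B(a_1)\times\cdots\times B(a_\mu)$ with all $a_i\ge a_*$, satisfying $|g(z_1,\ldots,z_\mu)|\le C$ on $\mathcal B$. Then for every subset $A\subset\{1,\ldots,n\}$ the von Neumann entropy $S_A$ of the reduced density matrix of $|\Psi\rangle$ on $A$ satisfies $$S_A\le c\,\mu\log n,$$ that is, $S_A=O(\mu\log n)$; consequently $S_A=O(k\log n)$. In particular, no family of such states (indexed by $n\to\infty$, with $\bar t,C,a_*$ fixed) with $k=O(1)$ nonlinearities can have volume law entanglement, i.e. $S_{A_n}\ge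 \kappa |A_n|$ for some fixed $\kappa>0$ along subsets $A_n$ with $|A_n|=\Theta(n)$.
   Context: Basis: $|\vec s\rangle$, $\vec s=(s_1,\ldots,s_n)\in\{\pm1\}^n$, is the standard product ($Z$-eigenbasis) orthonormal basis of $(\mathbb C^2)^{\otimes n}$; states are normalized, $\sum_{\vec s}|\Psi(\vec s)|^2=1$. For a subset $A$ of the qubits with complement $\bar A$, $\rho_A=\mathrm{Tr}_{\bar A}|\Psi\rangle\langle\Psi|$ and $S_A=-\mathrm{Tr}(\rho_A\log\rho_A)$. Feed-forward neural quantum state with $k$ scalar nonlinearities: $\Psi(\vec s)$ is computed by a finite directed acyclic graph whose nodes are: $n$ source nodes outputting $s_1,\ldots,s_n$; linear nodes, each outputting an affine combination $a_0+\sum_j a_jx^{(j)}$ of its inputs; exactly $k$ nonlinear nodes, each outputting $\sigma(b_0+\sum_j w_jx^{(j)})$ for its inputs $x^{(j)}$, with $\sigma$ a complex-valued scalar function that may differ from node to node; and a sink node outputting $\Psi(\vec s)$, affine in its inputs. Network parameters are real. Every such $\Psi$ can be written as a function $\mathcal G$ of at most $k+1$ affine features $t_i(\vec s)=\vec w_i^T\vec s+b_i$; the claim concerns such a representation. A "neural quantum state" is understood as a family labelled by $n$ ($\Psi$, $k$, $\mu$, $\mathcal G$, $\vec w_i$, $b_i$ may depend on $n$), and asymptotic notation refers to $n\to\infty$. Bernstein ellipse: for $a>0$, $B(a)=\{z=x+iy\in\mathbb C: x^2/\cosh^2(a)+y^2/\sinh^2(a)<1\}\supset[-1,1]$. *)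

theory Defs
  imports
    "HOL-Analysis.Analysis"
    "HOL-Library.Landau_Symbols"
    "Jordan_Normal_Form.Schur_Decomposition"
begin

section \<open>States of qubits and reduced density matrices\<close>

text \<open>
  The qubits are numbered \<open>0, \<dots>, n - 1\<close>. A basis label is an extensional function, so that
  there are exactly \<open>2 ^ card I\<close> of them over a finite set \<open>I\<close> of qubits. Operators are given
  by their entries in this product basis.
\<close>

definition spins :: "nat set \<Rightarrow> (nat \<Rightarrow> real) set" where
  "spins I = (\<Pi>\<^sub>E i\<in>I. {-1, 1})"

definition normalized_state :: "nat \<Rightarrow> ((nat \<Rightarrow> real) \<Rightarrow> complex) \<Rightarrow> bool" where
  "normalized_state n \<Psi> \<longleftrightarrow> (\<Sum>s\<in>spins {..<n}. (cmod (\<Psi> s))\<^sup>2) = 1"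

definition projector ::
  "((nat \<Rightarrow> real) \<Rightarrow> complex) \<Rightarrow> (nat \<Rightarrow> real) \<Rightarrow> (nat \<Rightarrow> real) \<Rightarrow> complex" where
  "projector \<Psi> s s' = \<Psi> s * cnj (\<Psi> s')"

text \<open>
  Here \<open>override_on \<tau> \<sigma> A\<close> is the label of the whole register that equals \<open>\<sigma>\<close> on \<open>A\<close> and
  \<open>\<tau>\<close> on the complement of \<open>A\<close>.
\<close>

definition partial_trace ::
  "nat \<Rightarrow> nat set \<Rightarrow> ((nat \<Rightarrow> real) \<Rightarrow> (nat \<Rightarrow> real) \<Rightarrow> complex)
    \<Rightarrow> (nat \<Rightarrow> real) \<Rightarrow> (nat \<Rightarrow> real) \<Rightarrow> complex" where
  "partial_trace n A R \<sigma> \<sigma>' =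
     (\<Sum>\<tau>\<in>spins ({..<n} - A). R (override_on \<tau> \<sigma> A) (override_on \<tau> \<sigma>' A))"

text \<open>
  The order in which the basis is listed is arbitrary; the entropy does not depend on it.
\<close>

definition matrix_of_operator ::
  "nat set \<Rightarrow> ((nat \<Rightarrow> real) \<Rightarrow> (nat \<Rightarrow> real) \<Rightarrow> complex) \<Rightarrow> complex mat" where
  "matrix_of_operator I R =
     mat (card (spins I)) (card (spins I))
       (\<lambda>(i, j). R (from_nat_into (spins I) i) (from_nat_into (spins I) j))"

definition reduced_density :: "nat \<Rightarrow> ((nat \<Rightarrow> real) \<Rightarrow> complex) \<Rightarrow> nat set \<Rightarrow> complex mat" where
  "reduced_density n \<Psi> A = matrix_of_operator A (partial_trace n A (projector \<Psi>))"


section \<open>Von Neumann entropy\<close>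

definition unitary_mat :: "nat \<Rightarrow> complex mat \<Rightarrow> bool" where
  "unitary_mat N U \<longleftrightarrow> U \<in> carrier_mat N N \<and>
     U * mat_adjoint U = 1\<^sub>m N \<and> mat_adjoint U * U = 1\<^sub>m N"

text \<open>
  Functional calculus of a Hermitian matrix \<open>M = U diag(d) U\<^sup>*\<close>. A suitable \<open>L\<close> exists and is
  unique whenever \<open>M\<close> is Hermitian.
\<close>

definition hermitian_calculus :: "(real \<Rightarrow> real) \<Rightarrow> complex mat \<Rightarrow> complex mat" where
  "hermitian_calculus f M = (SOME L. \<exists>U d.
     unitary_mat (dim_row M) U \<and>
     M = U * mat_diag (dim_row M) (\<lambda>i. complex_of_real (d i)) * mat_adjoint U \<and>
     L = U * mat_diag (dim_row M) (\<lambda>i. complex_of_real (f (d i))) * mat_adjoint U)"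

definition mat_trace :: "complex mat \<Rightarrow> complex" where
  "mat_trace M = (\<Sum>i<dim_row M. M $$ (i, i))"

text \<open>
  The logarithm is natural. Since \<^term>\<open>ln (0::real) = 0\<close>, zero eigenvalues contribute nothing,
  in accordance with the convention \<open>0 log 0 = 0\<close>. The trace is real for Hermitian \<open>\<rho>\<close>.
\<close>

definition von_neumann_entropy :: "complex mat \<Rightarrow> real" where
  "von_neumann_entropy \<rho> = - Re (mat_trace (\<rho> * hermitian_calculus ln \<rho>))"

definition entanglement_entropy :: "nat \<Rightarrow> ((nat \<Rightarrow> real) \<Rightarrow> complex) \<Rightarrow> nat set \<Rightarrow> real" where
  "entanglement_entropy n \<Psi> A = von_neumann_entropy (reduced_density n \<Psi> A)"

definition volume_law :: "(nat \<Rightarrow> (nat \<Rightarrow> real) \<Rightarrow> complex) \<Rightarrow> bool" where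
  "volume_law \<Psi> \<longleftrightarrow> (\<exists>A \<kappa>. \<kappa> > 0 \<and> (\<forall>n. A n \<subseteq> {..<n}) \<and>
     (\<lambda>n. real (card (A n))) \<in> \<Theta>(\<lambda>n. real n) \<and>
     (\<forall>\<^sub>F n in sequentially. entanglement_entropy n (\<Psi> n) (A n) \<ge> \<kappa> * real (card (A n))))"


section \<open>Feed-forward networks\<close>

text \<open>
  The parameters are real, but the nonlinearities are complex-valued and their outputs may be fed
  into further nodes; hence node values, and the arguments of the nonlinearities, are complex.
\<close>

datatype node = Source nat | Linear | Nonlinear "complex \<Rightarrow> complex" | Sink

record network =
  vertices :: "nat set"
  edges :: "(nat \<times> nat) set"
  kind :: "nat \<Rightarrow> node"
  bias :: "nat \<Rightarrow> real"
  weight :: "nat \<times> nat \<Rightarrow> real"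

definition feed_forward :: "nat \<Rightarrow> nat \<Rightarrow> network \<Rightarrow> bool" where
  "feed_forward n k N \<longleftrightarrow>
     finite (vertices N) \<and> edges N \<subseteq> vertices N \<times> vertices N \<and> acyclic (edges N) \<and>
     (\<forall>i<n. \<exists>!v. v \<in> vertices N \<and> kind N v = Source i) \<and>
     (\<forall>v\<in>vertices N. \<forall>i. kind N v = Source i \<longrightarrow> i < n \<and> (\<forall>u. (u, v) \<notin> edges N)) \<and>
     (\<exists>!v. v \<in> vertices N \<and> kind N v = Sink) \<and>
     (\<forall>v\<in>vertices N. kind N v = Sink \<longrightarrow> (\<forall>u. (v, u) \<notin> edges N)) \<and>
     card {v \<in> vertices N. \<exists>\<sigma>. kind N v = Nonlinear \<sigma>} = k"

definition affine_input :: "network \<Rightarrow> (nat \<Rightarrow> complex) \<Rightarrow> nat \<Rightarrow> complex" where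
  "affine_input N x v =
     complex_of_real (bias N v)
       + (\<Sum>u | (u, v) \<in> edges N. complex_of_real (weight N (u, v)) * x u)"

text \<open>
  On a finite acyclic graph these equations determine the node values \<open>x\<close> on the vertices
  uniquely.
\<close>

definition evaluates :: "network \<Rightarrow> (nat \<Rightarrow> real) \<Rightarrow> (nat \<Rightarrow> complex) \<Rightarrow> bool" where
  "evaluates N s x \<longleftrightarrow> (\<forall>v\<in>vertices N. x v = (case kind N v of
       Source i \<Rightarrow> complex_of_real (s i)
     | Linear \<Rightarrow> affine_input N x v
     | Nonlinear \<sigma> \<Rightarrow> \<sigma> (affine_input N x v)
     | Sink \<Rightarrow> affine_input N x v))"

definition feed_forward_nqs :: "nat \<Rightarrow> nat \<Rightarrow> ((nat \<Rightarrow> real) \<Rightarrow> complex) \<Rightarrow> bool" where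
  "feed_forward_nqs n k \<Psi> \<longleftrightarrow> (\<exists>N. feed_forward n k N \<and>
     (\<forall>s\<in>spins {..<n}. \<exists>x. evaluates N s x \<and>
        (\<forall>v\<in>vertices N. kind N v = Sink \<longrightarrow> x v = \<Psi> s)))"


section \<open>Analytic functions of several variables\<close>

definition bernstein_ellipse :: "real \<Rightarrow> complex set" where
  "bernstein_ellipse a = {z. (Re z)\<^sup>2 / (cosh a)\<^sup>2 + (Im z)\<^sup>2 / (sinh a)\<^sup>2 < 1}"

text \<open>
  Points of \<open>m\<close>-dimensional space are extensional functions on \<open>{..<m}\<close>, and so are
  multi-indices \<open>e\<close>. Analyticity on an open set \<open>S\<close>: near each point of \<open>S\<close>, the function is
  the sum of an (unconditionally) convergent power series in all \<open>m\<close> variables.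
\<close>

definition analytic_several ::
  "nat \<Rightarrow> ((nat \<Rightarrow> complex) \<Rightarrow> complex) \<Rightarrow> (nat \<Rightarrow> complex) set \<Rightarrow> bool" where
  "analytic_several m f S \<longleftrightarrow> (\<forall>p\<in>S. \<exists>r>0. \<exists>\<alpha>.
     \<forall>z \<in> (\<Pi>\<^sub>E i\<in>{..<m}. ball (p i) r).
       ((\<lambda>e. \<alpha> e * (\<Prod>i<m. (z i - p i) ^ e i)) has_sum f z)
         (\<Pi>\<^sub>E i\<in>{..<m}. (UNIV :: nat set)))"

definition bounded_bernstein_extension ::
  "real \<Rightarrow> real \<Rightarrow> nat \<Rightarrow> ((nat \<Rightarrow> real) \<Rightarrow> complex) \<Rightarrow> bool" where
  "bounded_bernstein_extension C a_min m g \<longleftrightarrow>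
     (\<exists>a h. (\<forall>i<m. a i \<ge> a_min) \<and>
        analytic_several m h (\<Pi>\<^sub>E i\<in>{..<m}. bernstein_ellipse (a i)) \<and>
        (\<forall>x \<in> (\<Pi>\<^sub>E i\<in>{..<m}. {-1..1}). h (\<lambda>i\<in>{..<m}. complex_of_real (x i)) = g x) \<and>
        (\<forall>z \<in> (\<Pi>\<^sub>E i\<in>{..<m}. bernstein_ellipse (a i)). cmod (h z) \<le> C))"


section \<open>Neural quantum states with an analytic representation by affine features\<close>

definition feature :: "nat \<Rightarrow> (nat \<Rightarrow> real) \<Rightarrow> real \<Rightarrow> (nat \<Rightarrow> real) \<Rightarrow> real" where
  "feature n w b s = (\<Sum>j<n. w j * s j) + b"

definition analytic_nqs ::
  "real \<Rightarrow> real \<Rightarrow> real \<Rightarrow> nat \<Rightarrow> nat \<Rightarrow> ((nat \<Rightarrow> real) \<Rightarrow> complex)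
    \<Rightarrow> nat \<Rightarrow> ((nat \<Rightarrow> real) \<Rightarrow> complex) \<Rightarrow> (nat \<Rightarrow> nat \<Rightarrow> real) \<Rightarrow> (nat \<Rightarrow> real) \<Rightarrow> bool" where
  "analytic_nqs t_bar C a_min n k \<Psi> \<mu> G w b \<longleftrightarrow>
     normalized_state n \<Psi> \<and>
     feed_forward_nqs n k \<Psi> \<and>
     1 \<le> \<mu> \<and> \<mu> \<le> k + 1 \<and>
     (\<forall>s\<in>spins {..<n}. \<Psi> s = G (\<lambda>i\<in>{..<\<mu>}. feature n (w i) (b i) s)) \<and>
     (SUP (s, i) \<in> spins {..<n} \<times> {..<\<mu>}. \<bar>feature n (w i) (b i) s\<bar>) < t_bar \<and>
     bounded_bernstein_extension C a_min \<mu> (\<lambda>x. G (\<lambda>i\<in>{..<\<mu>}. t_bar * x i))"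

end

(* Since A and its complement contribute additively to each affine feature, replacing g by a
   polynomial of degree below D in each of its \<mu> variables turns the amplitudes, viewed as a matrix
   with rows labelled by A and columns by the complement, into a matrix of rank at most D^\<mu>.
   Analyticity makes the error decay like R^(-D) for some R > 1, up to factors that are harmless for
   \<mu> \<le> n; so D of order n^2 yields an error below 4^(-n). Then at most D^\<mu> eigenvalues of the
   reduced density matrix exceed 4^(-n), and the entropy is at most \<mu> ln D + 3. For \<mu> > n the bound
   n ln 2 suffices. The polynomial is obtained by Lagrange interpolation in one variable after
   another, so that only one-variable analyticity is needed; at Fekete points the interpolation
   operator has norm at most D. *)
theory Submission
  imports
    Defs
    "HOL-Complex_Analysis.Complex_Analysis"
    "HOL-Real_Asymp.Real_Asymp"
    "Jordan_Normal_Form.Spectral_Radius"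
begin

section \<open>Hermitian matrices\<close>

text \<open>Only the finitely many values that the rescaled features take on spin configurations
  matter for interpolation. Maximizing the Vandermonde determinant over node sets among them is
  therefore a finite problem, and the price is a factor \<open>D\<close> per variable,
  \<open>D ^ \<mu>\<close> in total. This loss has to be beaten by \<open>R ^ D\<close>. A degree of
  order n log n would already do so; a quadratic one permits comparing n-th roots and still gives ln
  D = O(log n).

  The eigenvalue threshold 4^(-n) comes from -x ln x <= 2 sqrt x: each of the at most 2^n small
  eigenvalues contributes at most 2 * 2^(-n), so together they cost a constant. The large
  eigenvalues are counted by a dimension argument on the quadratic form of the density matrix, which
  avoids singular values.

  The constants are uniform because every admissible ellipse contains the one with parameter
  \<open>a_min\<close>: one contour and one pair \<open>K\<close>, \<open>R\<close> serve all slices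
  of all functions \<open>g\<close>.\<close>

text \<open>Gaussian elimination: a nonzero coefficient of the last equation at \<open>p\<close>
  expresses \<open>x p\<close> through the other unknowns, of which there are still more than the
  remaining \<open>m\<close> equations. It serves both to extend orthonormal systems and to find, in
  the span of too many eigenvectors, a vector orthogonal to a low-rank approximation.\<close>

lemma underdetermined_system:
  fixes a :: "nat \<Rightarrow> 'i \<Rightarrow> 'a :: field"
  assumes "finite I" "m < card I"
  shows "\<exists>x. (\<exists>i\<in>I. x i \<noteq> 0) \<and> (\<forall>k<m. (\<Sum>i\<in>I. a k i * x i) = 0)"
  using assms
proof (induction m arbitrary: I a)
  case 0
  then have "I \<noteq> {}" by auto
  then show ?case by (intro exI[of _ "\<lambda>_. 1"]) auto
next
  case (Suc m)
  show ?case
  proof (cases "\<forall>i\<in>I. a m i = 0")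
    case True
    obtain x where "\<exists>i\<in>I. x i \<noteq> 0" "\<forall>k<m. (\<Sum>i\<in>I. a k i * x i) = 0"
      using Suc.IH[of I a] Suc.prems by auto
    with True show ?thesis
      by (intro exI[of _ x]) (auto simp: less_Suc_eq)
  next
    case False
    then obtain p where p: "p \<in> I" "a m p \<noteq> 0" by auto
    define J where "J = I - {p}"
    have J: "finite J" "m < card J" "p \<notin> J" "I = insert p J"
      using Suc.prems p by (auto simp: J_def card_Diff_singleton)
    obtain x where x: "\<exists>i\<in>J. x i \<noteq> 0"
      "\<forall>k<m. (\<Sum>i\<in>J. (a k i - a k p * a m i / a m p) * x i) = 0"
      using Suc.IH[of J "\<lambda>k i. a k i - a k p * a m i / a m p"] J by auto
    \<comment> \<open>The value at \<open>p\<close> is the one that solves equation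
      \<open>m\<close>.\<close>
    define y where "y = x(p := - (\<Sum>i\<in>J. a m i * x i) / a m p)"
    have ysum: "(\<Sum>i\<in>J. c i * y i) = (\<Sum>i\<in>J. c i * x i)" for c
      using J by (intro sum.cong) (auto simp: y_def)
    have "(\<Sum>i\<in>I. a k i * y i) = 0" if "k < Suc m" for k
    proof (cases "k = m")
      case True
      then show ?thesis using J p by (simp add: ysum) (simp add: y_def)
    next
      case False
      with that x have "0 = (\<Sum>i\<in>J. (a k i - a k p * a m i / a m p) * x i)" by auto
      also have "\<dots> = (\<Sum>i\<in>J. a k i * x i) - a k p / a m p * (\<Sum>i\<in>J. a m i * x i)"
        by (simp add: sum_subtractf[symmetric] sum_distrib_left algebra_simps)
      finally show ?thesis using J p by (simp add: ysum) (simp add: y_def)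
    qed
    moreover have "\<exists>i\<in>I. y i \<noteq> 0" using x(1) J by (auto simp: y_def)
    ultimately show ?thesis by blast
  qed
qed

section \<open>Orthonormal systems in coordinates\<close>

text \<open>Conjugate-linear in the first argument. Vectors are plain functions of which only the
  values below \<open>N\<close> count, so that sums, multiples and updates of families carry no
  dimension conditions.\<close>

definition inner_upto :: "nat \<Rightarrow> (nat \<Rightarrow> complex) \<Rightarrow> (nat \<Rightarrow> complex) \<Rightarrow> complex" where
  "inner_upto N u v = (\<Sum>i<N. cnj (u i) * v i)"

definition orthonormal_upto :: "nat \<Rightarrow> nat \<Rightarrow> (nat \<Rightarrow> nat \<Rightarrow> complex) \<Rightarrow> bool" where
  "orthonormal_upto N m u \<longleftrightarrow>
     (\<forall>j<m. \<forall>k<m. inner_upto N (u j) (u k) = (if j = k then 1 else 0))"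

lemma inner_upto_self: "inner_upto N u u = complex_of_real (\<Sum>i<N. (cmod (u i))\<^sup>2)"
  unfolding inner_upto_def of_real_sum
  by (intro sum.cong) (auto simp: complex_norm_square[symmetric] mult.commute)

lemma inner_upto_commute: "inner_upto N v u = cnj (inner_upto N u v)"
  by (simp add: inner_upto_def mult.commute)

lemma inner_upto_self_pos:
  fixes x :: "nat \<Rightarrow> complex"
  assumes "i < N" "x i \<noteq> 0"
  shows "(\<Sum>i<N. (cmod (x i))\<^sup>2) > 0"
  by (rule sum_pos2[of _ i]) (use assms in auto)

lemma normalize_vector:
  assumes "i < N" "x i \<noteq> 0"
  obtains c :: complex where "c \<noteq> 0" "inner_upto N (\<lambda>i. c * x i) (\<lambda>i. c * x i) = 1"
proof
  define s where "s = (\<Sum>i<N. (cmod (x i))\<^sup>2)"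
  have s: "s > 0" unfolding s_def by (rule inner_upto_self_pos[of i]) (use assms in auto)
  show "complex_of_real (1 / sqrt s) \<noteq> 0" using s by simp
  have "(\<Sum>i<N. (cmod (complex_of_real (1 / sqrt s) * x i))\<^sup>2) = (\<Sum>i<N. (cmod (x i))\<^sup>2 / s)"
    using s by (intro sum.cong) (auto simp: norm_mult power_mult_distrib norm_divide power_divide)
  also have "\<dots> = 1" using s by (simp add: sum_divide_distrib[symmetric] s_def)
  finally show "inner_upto N (\<lambda>i. complex_of_real (1 / sqrt s) * x i)
      (\<lambda>i. complex_of_real (1 / sqrt s) * x i) = 1"
    by (simp only: inner_upto_self)  simp
qed

lemma inner_upto_scale_right: "inner_upto N u (\<lambda>i. c * x i) = c * inner_upto N u x"
  by (simp add: inner_upto_def sum_distrib_left algebra_simps)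

lemma orthonormal_upto_Suc:
  assumes "orthonormal_upto N m u" "\<And>j. j < m \<Longrightarrow> inner_upto N (u j) v = 0" "inner_upto N v v = 1"
  shows "orthonormal_upto N (Suc m) (u(m := v))"
proof -
  have "inner_upto N v (u j) = 0" if "j < m" for j
    using assms(2)[OF that] inner_upto_commute[of N v "u j"] by simp
  then show ?thesis using assms unfolding orthonormal_upto_def by (auto simp: less_Suc_eq)
qed

lemma orthonormal_upto_extend:
  assumes "orthonormal_upto N m u" "m < N"
  shows "\<exists>v. orthonormal_upto N (Suc m) (u(m := v))"
proof -
  obtain x where x: "\<exists>i\<in>{..<N}. x i \<noteq> 0" "\<forall>k<m. (\<Sum>i<N. cnj (u k i) * x i) = 0"
    using underdetermined_system[of "{..<N}" m "\<lambda>k i. cnj (u k i)"] assms by auto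
  obtain i where i: "i < N" "x i \<noteq> 0" using x(1) by auto
  obtain c where c: "inner_upto N (\<lambda>i. c * x i) (\<lambda>i. c * x i) = 1"
    using normalize_vector[of i N x] i by blast
  have "inner_upto N (u j) (\<lambda>i. c * x i) = 0" if "j < m" for j
    using x(2) that by (simp add: inner_upto_scale_right) (simp add: inner_upto_def)
  then show ?thesis using orthonormal_upto_Suc[OF assms(1) _ c] by blast
qed

lemma orthonormal_upto_basis:
  assumes "orthonormal_upto N m u" "m \<le> N"
  obtains u' where "orthonormal_upto N N u'" "\<And>j. j < m \<Longrightarrow> u' j = u j"
proof -
  have "\<exists>u'. orthonormal_upto N k u' \<and> (\<forall>j<m. u' j = u j)" if "m \<le> k" "k \<le> N" for k
    using that
  proof (induction k rule: dec_induct)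
    case base
    then show ?case using assms by blast
  next
    case (step k)
    then obtain u' where u': "orthonormal_upto N k u'" "\<forall>j<m. u' j = u j" by auto
    obtain v where "orthonormal_upto N (Suc k) (u'(k := v))"
      using orthonormal_upto_extend[OF u'(1)] step.prems by auto
    moreover have "\<forall>j<m. (u'(k := v)) j = u j" using u'(2) step by auto
    ultimately show ?case by blast
  qed
  then show ?thesis using assms that by blast
qed

definition basis_mat :: "nat \<Rightarrow> (nat \<Rightarrow> nat \<Rightarrow> complex) \<Rightarrow> complex mat" where
  "basis_mat N u = Matrix.mat N N (\<lambda>(i, j). u j i)"

lemma basis_mat_index: "i < N \<Longrightarrow> j < N \<Longrightarrow> basis_mat N u $$ (i, j) = u j i"
  by (simp add: basis_mat_def)

lemma mat_adjoint_carrier: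
  "U \<in> carrier_mat n m \<Longrightarrow> mat_adjoint U \<in> carrier_mat m n"
  by (auto simp: mat_adjoint_def mat_of_rows_def)

lemma mat_adjoint_index:
  assumes "U \<in> carrier_mat n m" "i < m" "j < n"
  shows "mat_adjoint U $$ (i, j) = cnj (U $$ (j, i))"
  using assms by (auto simp: mat_adjoint_def mat_of_rows_index)

text \<open>Orthonormal columns make the adjoint a left inverse, and for a square matrix a left
  inverse is also a right inverse. The second half says that the rows are orthonormal too, which is
  the completeness relation behind expansions in the basis.\<close>

lemma unitary_basis_mat:
  assumes "orthonormal_upto N N u"
  shows "unitary_mat N (basis_mat N u)"
proof -
  let ?U = "basis_mat N u"
  have U: "?U \<in> carrier_mat N N" by (simp add: basis_mat_def)
  note Ua = mat_adjoint_carrier[OF U]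
  have "mat_adjoint ?U * ?U = 1\<^sub>m N"
  proof (rule eq_matI)
    fix i j assume "i < dim_row (1\<^sub>m N :: complex mat)" "j < dim_col (1\<^sub>m N :: complex mat)"
    then have ij: "i < N" "j < N" by auto
    have "(mat_adjoint ?U * ?U) $$ (i, j) = inner_upto N (u i) (u j)"
      using ij U Ua by (auto simp: scalar_prod_def mat_adjoint_index[OF U] inner_upto_def
          basis_mat_index atLeast0LessThan intro!: sum.cong)
    then show "(mat_adjoint ?U * ?U) $$ (i, j) = 1\<^sub>m N $$ (i, j)"
      using assms ij by (auto simp: orthonormal_upto_def)
  qed (use U Ua in auto)
  then show ?thesis
    using U Ua mat_mult_left_right_inverse[OF Ua U] by (simp add: unitary_mat_def)
qed

lemma unitary_rows_orthonormal:
  assumes "unitary_mat N U" "i < N" "l < N"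
  shows "(\<Sum>j<N. U $$ (i, j) * cnj (U $$ (l, j))) = (if i = l then 1 else 0)"
proof -
  have U: "U \<in> carrier_mat N N" "U * mat_adjoint U = 1\<^sub>m N"
    using assms by (auto simp: unitary_mat_def)
  have "(\<Sum>j<N. U $$ (i, j) * cnj (U $$ (l, j))) = (U * mat_adjoint U) $$ (i, l)"
    using U(1) mat_adjoint_carrier[OF U(1)] assms
    by (auto simp: scalar_prod_def mat_adjoint_index[OF U(1)] atLeast0LessThan intro!: sum.cong)
  then show ?thesis using U(2) assms by auto
qed

lemma unitary_cols_orthonormal:
  assumes "unitary_mat N U"
  shows "orthonormal_upto N N (\<lambda>j i. U $$ (i, j))"
proof -
  have U: "U \<in> carrier_mat N N" "mat_adjoint U * U = 1\<^sub>m N"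
    using assms by (auto simp: unitary_mat_def)
  have "inner_upto N (\<lambda>i. U $$ (i, j)) (\<lambda>i. U $$ (i, k)) = (mat_adjoint U * U) $$ (j, k)"
    if "j < N" "k < N" for j k
    using U(1) mat_adjoint_carrier[OF U(1)] that
    by (auto simp: scalar_prod_def mat_adjoint_index[OF U(1)] atLeast0LessThan inner_upto_def
        intro!: sum.cong)
  then show ?thesis unfolding orthonormal_upto_def by (auto simp: U(2))
qed

lemma orthonormal_upto_expand:
  assumes "orthonormal_upto N N u" "i < N"
  shows "v i = (\<Sum>j<N. inner_upto N (u j) v * u j i)"
proof -
  have "(\<Sum>j<N. inner_upto N (u j) v * u j i) = (\<Sum>l<N. v l * (\<Sum>j<N. u j i * cnj (u j l)))"
    unfolding inner_upto_def sum_distrib_left sum_distrib_right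
    by (subst sum.swap) (simp add: mult_ac)
  also have "\<dots> = (\<Sum>l<N. v l * (if i = l then 1 else 0))"
    using unitary_rows_orthonormal[OF unitary_basis_mat[OF assms(1)] assms(2)] assms(2)
    by (intro sum.cong) (auto simp: basis_mat_def)
  also have "\<dots> = v i" using assms(2) by (simp add: if_distrib cong: if_cong)
  finally show ?thesis by simp
qed

section \<open>The spectral theorem\<close>

definition apply_op :: "nat \<Rightarrow> (nat \<Rightarrow> nat \<Rightarrow> complex) \<Rightarrow> (nat \<Rightarrow> complex) \<Rightarrow> nat \<Rightarrow> complex" where
  "apply_op N A v i = (\<Sum>l<N. A i l * v l)"

lemma inner_upto_hermitian:
  assumes "\<And>i j. i < N \<Longrightarrow> j < N \<Longrightarrow> A j i = cnj (A i j)"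
  shows "inner_upto N u (apply_op N A v) = inner_upto N (apply_op N A u) v"
proof -
  have "inner_upto N u (apply_op N A v) = (\<Sum>i<N. \<Sum>l<N. cnj (u i) * A i l * v l)"
    by (simp add: inner_upto_def apply_op_def sum_distrib_left mult.assoc)
  also have "\<dots> = (\<Sum>l<N. \<Sum>i<N. cnj (u i) * A i l * v l)" by (rule sum.swap)
  also have "\<dots> = (\<Sum>l<N. \<Sum>i<N. cnj (A l i * u i) * v l)"
  proof (intro sum.cong refl)
    fix i l assume "i \<in> {..<N}" "l \<in> {..<N}"
    then have "A i l = cnj (A l i)" using assms by blast
    then show "cnj (u i) * A i l * v l = cnj (A l i * u i) * v l" by simp
  qed
  also have "\<dots> = inner_upto N (apply_op N A u) v"
    by (simp add: inner_upto_def apply_op_def sum_distrib_right)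
  finally show ?thesis .
qed

text \<open>Algebraic closedness of the complex numbers supplies an eigenvalue, not yet a real
  one.\<close>

lemma eigenvector_function:
  fixes A :: "nat \<Rightarrow> nat \<Rightarrow> complex"
  assumes "N > 0"
  obtains e y where "\<exists>i<N. y i \<noteq> 0" "\<And>i. i < N \<Longrightarrow> apply_op N A y i = e * y i"
proof -
  let ?M = "Matrix.mat N N (\<lambda>(i, j). A i j)"
  obtain e where "eigenvalue ?M e"
    using spectrum_non_empty[of ?M N] assms by (auto simp: spectrum_def)
  then obtain v where v: "v \<in> carrier_vec N" "v \<noteq> 0\<^sub>v N" "?M *\<^sub>v v = e \<cdot>\<^sub>v v"
    by (auto simp: eigenvalue_def eigenvector_def)
  have "\<exists>i<N. v $ i \<noteq> 0" using v(1,2) by (metis eq_vecI carrier_vecD index_zero_vec)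
  moreover have "apply_op N A (\<lambda>i. v $ i) i = e * v $ i" if "i < N" for i
  proof -
    have "(?M *\<^sub>v v) $ i = apply_op N A (\<lambda>i. v $ i) i"
      using that v(1) by (auto simp: scalar_prod_def apply_op_def atLeast0LessThan intro!: sum.cong)
    then show ?thesis using v(1,3) that by simp
  qed
  ultimately show ?thesis using that by blast
qed

lemma inner_upto_sum_right:
  "inner_upto N u (\<lambda>i. \<Sum>k\<in>K. f k i) = (\<Sum>k\<in>K. inner_upto N u (f k))"
  unfolding inner_upto_def sum_distrib_left by (rule sum.swap)

lemma apply_op_sum: "apply_op N A (\<lambda>i. \<Sum>k\<in>K. f k i) i = (\<Sum>k\<in>K. apply_op N A (f k) i)"
  unfolding apply_op_def sum_distrib_left by (rule sum.swap)

lemma apply_op_scale: "apply_op N A (\<lambda>i. c * x i) i = c * apply_op N A x i"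
  by (simp add: apply_op_def sum_distrib_left algebra_simps)

text \<open>The compression of \<open>A\<close> to the orthogonal complement of the eigenvectors found so far
  has an eigenvector; it lifts because that complement is invariant.\<close>

lemma hermitian_next_eigenvector:
  assumes herm: "\<And>i j. i < N \<Longrightarrow> j < N \<Longrightarrow> A j i = cnj (A i j)"
    and u: "orthonormal_upto N m u" and m: "m < N"
    and eig: "\<And>j i. j < m \<Longrightarrow> i < N \<Longrightarrow> apply_op N A (u j) i = complex_of_real (d j) * u j i"
  obtains v e where "orthonormal_upto N (Suc m) (u(m := v))"
    "\<And>i. i < N \<Longrightarrow> apply_op N A v i = complex_of_real e * v i"
proof -
  have adj: "inner_upto N v (apply_op N A v') = inner_upto N (apply_op N A v) v'" for v v'
    by (rule inner_upto_hermitian) (fact herm)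
  obtain b where b: "orthonormal_upto N N b" "\<And>j. j < m \<Longrightarrow> b j = u j"
    using orthonormal_upto_basis[OF u] m by auto
  define w where "w l = b (m + l)" for l
  define A' where "A' j l = inner_upto N (w j) (apply_op N A (w l))" for j l
  obtain e y where y: "\<exists>l<N - m. y l \<noteq> 0" "\<And>j. j < N - m \<Longrightarrow> apply_op (N - m) A' y j = e * y j"
    using eigenvector_function[of "N - m" A'] m by (metis zero_less_diff)
  define x where "x i = (\<Sum>l<N - m. y l * w l i)" for i
  have wx: "inner_upto N (b j) x = (if j < m then 0 else y (j - m))" if "j < N" for j
  proof -
    have "inner_upto N (b j) x = (\<Sum>l<N - m. y l * inner_upto N (b j) (w l))"
      unfolding x_def inner_upto_sum_right by (simp add: inner_upto_scale_right)
    also have "\<dots> = (\<Sum>l<N - m. y l * (if j = m + l then 1 else 0))"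
      using b(1) that by (intro sum.cong refl) (auto simp: orthonormal_upto_def w_def)
    also have "\<dots> = (if j < m then 0 else y (j - m))"
    proof (cases "j < m")
      case False
      then have "(\<Sum>l<N - m. y l * (if j = m + l then 1 else 0))
          = (\<Sum>l<N - m. if l = j - m then y l else 0)"
        by (intro sum.cong) auto
      then show ?thesis using False that by auto
    qed auto
    finally show ?thesis .
  qed
  \<comment> \<open>\<open>apply_op N A x\<close> and \<open>e\<close> times \<open>x\<close> are
    compared coordinate by coordinate in the basis \<open>b\<close>. At an old eigenvector both
    coordinates vanish, because \<open>A\<close> can be moved to the other side and \<open>x\<close>
    is orthogonal to \<open>u j\<close>; at the remaining basis vectors the equality is the
    eigenvalue equation of the compression \<open>A'\<close>.\<close>
  have bA: "inner_upto N (b j) (apply_op N A x) = e * inner_upto N (b j) x" if j: "j < N" for j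
  proof (cases "j < m")
    case True
    have "inner_upto N (b j) (apply_op N A x) = inner_upto N (apply_op N A (u j)) x"
      using adj b(2)[OF True] by simp
    also have "\<dots> = inner_upto N (\<lambda>i. complex_of_real (d j) * u j i) x"
      unfolding inner_upto_def by (intro sum.cong) (auto simp: eig[OF True])
    also have "\<dots> = complex_of_real (d j) * inner_upto N (b j) x"
      using b(2)[OF True] by (simp add: inner_upto_def sum_distrib_left algebra_simps)
    also have "\<dots> = e * inner_upto N (b j) x" using wx[OF j] True by simp
    finally show ?thesis .
  next
    case False
    have jm: "j - m < N - m" using False j by auto
    have "inner_upto N (b j) (apply_op N A x)
        = inner_upto N (b j) (\<lambda>i. \<Sum>l<N - m. y l * apply_op N A (w l) i)"
      unfolding x_def inner_upto_def by (simp only: apply_op_sum apply_op_scale)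
    also have "\<dots> = (\<Sum>l<N - m. y l * inner_upto N (b j) (apply_op N A (w l)))"
      by (simp only: inner_upto_sum_right inner_upto_scale_right)
    also have "\<dots> = apply_op (N - m) A' y (j - m)"
      using False by (simp add: apply_op_def A'_def w_def mult.commute)
    also have "\<dots> = e * inner_upto N (b j) x" using y(2)[OF jm] wx[OF j] False by simp
    finally show ?thesis .
  qed
  have Ax: "apply_op N A x i = e * x i" if "i < N" for i
  proof -
    have "apply_op N A x i = (\<Sum>j<N. inner_upto N (b j) (apply_op N A x) * b j i)"
      by (rule orthonormal_upto_expand[OF b(1) that])
    also have "\<dots> = e * (\<Sum>j<N. inner_upto N (b j) x * b j i)"
      by (simp add: bA sum_distrib_left mult.assoc)
    also have "\<dots> = e * x i" using orthonormal_upto_expand[OF b(1) that, of x] by simp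
    finally show ?thesis .
  qed
  have "\<exists>i<N. x i \<noteq> 0"
  proof (rule ccontr)
    assume "\<not> (\<exists>i<N. x i \<noteq> 0)"
    then have "inner_upto N (b (m + l)) x = 0" for l by (simp add: inner_upto_def)
    with y(1) wx show False by (metis add_diff_cancel_left' less_diff_conv add.commute not_add_less1)
  qed
  then obtain i where i: "i < N" "x i \<noteq> 0" by blast
  obtain c where c: "inner_upto N (\<lambda>i. c * x i) (\<lambda>i. c * x i) = 1"
    using normalize_vector[of i N x] i by blast
  define v where "v i = c * x i" for i
  have vv: "inner_upto N v v = 1" using c by (simp add: v_def[abs_def])
  have Av: "apply_op N A v i = e * v i" if "i < N" for i
    using Ax[OF that] by (simp add: v_def[abs_def] apply_op_scale mult.left_commute)
  \<comment> \<open>The Rayleigh quotient of the unit vector \<open>v\<close> equals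
    \<open>e\<close> and, by symmetry of \<open>A\<close>, also its conjugate; hence
    \<open>e\<close> is real.\<close>
  have "inner_upto N v (apply_op N A v) = e"
    using vv Av by (simp add: inner_upto_def mult.left_commute sum_distrib_left[symmetric])
  moreover have "inner_upto N (apply_op N A v) v = cnj e"
    using vv Av by (simp add: inner_upto_def mult.assoc sum_distrib_left[symmetric])
  ultimately have "e = cnj e" using adj[of v v] by simp
  then have e: "e = complex_of_real (Re e)" by (simp add: complex_eq_iff)
  have "inner_upto N (u j) v = 0" if "j < m" for j
    using wx[of j] b(2)[OF that] that m by (simp add: v_def[abs_def] inner_upto_scale_right)
  then have "orthonormal_upto N (Suc m) (u(m := v))" by (rule orthonormal_upto_Suc[OF u _ vv])
  with Av e show ?thesis using that by metis
qed

lemma hermitian_eigenbasis: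
  assumes herm: "\<And>i j. i < N \<Longrightarrow> j < N \<Longrightarrow> A j i = cnj (A i j)"
  obtains u d where "orthonormal_upto N N u"
    "\<And>j i. j < N \<Longrightarrow> i < N \<Longrightarrow> apply_op N A (u j) i = complex_of_real (d j) * u j i"
proof -
  have "\<exists>u d. orthonormal_upto N m u \<and>
      (\<forall>j<m. \<forall>i<N. apply_op N A (u j) i = complex_of_real (d j) * u j i)" if "m \<le> N" for m
    using that
  proof (induction m)
    case 0
    then show ?case by (auto simp: orthonormal_upto_def)
  next
    case (Suc m)
    then obtain u d where ud: "orthonormal_upto N m u"
      "\<forall>j<m. \<forall>i<N. apply_op N A (u j) i = complex_of_real (d j) * u j i" by auto
    obtain v e where ve: "orthonormal_upto N (Suc m) (u(m := v))"
      "\<And>i. i < N \<Longrightarrow> apply_op N A v i = complex_of_real e * v i"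
      using hermitian_next_eigenvector[of N A m u d] herm ud Suc.prems by (metis Suc_le_lessD)
    moreover have "apply_op N A ((u(m := v)) j) i = complex_of_real ((d(m := e)) j) * (u(m := v)) j i"
      if "j < Suc m" "i < N" for j i
      using that ud(2) ve(2) by (cases "j = m") auto
    ultimately show ?case by blast
  qed
  then show ?thesis using that by blast
qed

section \<open>Entropy in terms of eigenvalues\<close>

lemma mat_trace_comm:
  assumes "A \<in> carrier_mat n n" "B \<in> carrier_mat n n"
  shows "mat_trace (A * B) = mat_trace (B * A)"
proof -
  have tr: "mat_trace (X * Y) = (\<Sum>i<n. \<Sum>j<n. X $$ (i, j) * Y $$ (j, i))"
    if "X \<in> carrier_mat n n" "Y \<in> carrier_mat n n" for X Y
    using that by (auto simp: mat_trace_def scalar_prod_def atLeast0LessThan intro!: sum.cong)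
  show ?thesis
    unfolding tr[OF assms] tr[OF assms(2,1)] by (subst sum.swap) (simp add: mult.commute)
qed

text \<open>This existence statement gives content to the \<open>SOME\<close> in
  \<open>hermitian_calculus\<close>.\<close>

lemma spectral_decomposition:
  assumes \<rho>: "\<rho> \<in> carrier_mat N N"
    and herm: "\<And>i j. i < N \<Longrightarrow> j < N \<Longrightarrow> \<rho> $$ (j, i) = cnj (\<rho> $$ (i, j))"
  obtains U d where "unitary_mat N U"
    "\<rho> = U * mat_diag N (\<lambda>i. complex_of_real (d i)) * mat_adjoint U"
proof -
  obtain u d where ud: "orthonormal_upto N N u"
    "\<And>j i. j < N \<Longrightarrow> i < N \<Longrightarrow> apply_op N (\<lambda>i l. \<rho> $$ (i, l)) (u j) i = complex_of_real (d j) * u j i"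
    using hermitian_eigenbasis[of N "\<lambda>i l. \<rho> $$ (i, l)"] herm by metis
  define U where "U = basis_mat N u"
  let ?D = "mat_diag N (\<lambda>i. complex_of_real (d i))"
  have unit: "unitary_mat N U" using unitary_basis_mat[OF ud(1)] by (simp add: U_def)
  have U: "U \<in> carrier_mat N N" "U * mat_adjoint U = 1\<^sub>m N"
    using unit by (auto simp: unitary_mat_def)
  note Ua = mat_adjoint_carrier[OF U(1)]
  have "\<rho> * U = U * ?D"
  proof (rule eq_matI)
    fix i j assume "i < dim_row (U * ?D)" "j < dim_col (U * ?D)"
    then have ij: "i < N" "j < N" using U by (auto simp: mat_diag_def)
    have "(\<rho> * U) $$ (i, j) = apply_op N (\<lambda>i l. \<rho> $$ (i, l)) (u j) i"
      using ij U \<rho> by (auto simp: scalar_prod_def apply_op_def U_def basis_mat_index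
          atLeast0LessThan intro!: sum.cong)
    also have "\<dots> = (U * ?D) $$ (i, j)"
      unfolding mat_diag_mult_right[OF U(1)] using ij by (simp add: ud(2) U_def basis_mat_index)
    finally show "(\<rho> * U) $$ (i, j) = (U * ?D) $$ (i, j)" .
  qed (use U \<rho> in \<open>auto simp: mat_diag_def\<close>)
  moreover have "\<rho> = \<rho> * U * mat_adjoint U"
    using \<rho> U Ua by (simp add: assoc_mult_mat[OF \<rho> U(1) Ua])
  ultimately show ?thesis using unit that by metis
qed

text \<open>The diagonalization is whichever one the choice operator selects: its columns form an
  orthonormal eigenbasis, and cyclicity of the trace moves the outer unitary around to cancel,
  leaving a product of diagonal matrices.\<close>

lemma von_neumann_entropy_eigenvalues:
  assumes \<rho>: "\<rho> \<in> carrier_mat N N"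
    and herm: "\<And>i j. i < N \<Longrightarrow> j < N \<Longrightarrow> \<rho> $$ (j, i) = cnj (\<rho> $$ (i, j))"
  obtains u d where "orthonormal_upto N N u"
    "\<And>j i. j < N \<Longrightarrow> i < N \<Longrightarrow> apply_op N (\<lambda>i l. \<rho> $$ (i, l)) (u j) i = complex_of_real (d j) * u j i"
    "von_neumann_entropy \<rho> = - (\<Sum>j<N. d j * ln (d j))"
proof -
  let ?D = "\<lambda>d::nat \<Rightarrow> real. mat_diag N (\<lambda>i. complex_of_real (d i))"
  define L where "L = hermitian_calculus ln \<rho>"
  obtain U0 d0 where "unitary_mat N U0" "\<rho> = U0 * ?D d0 * mat_adjoint U0"
    using spectral_decomposition[OF \<rho>] herm by blast
  moreover have dim: "dim_row \<rho> = N" using \<rho> by simp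
  ultimately have "\<exists>L U d. unitary_mat (dim_row \<rho>) U \<and>
     \<rho> = U * mat_diag (dim_row \<rho>) (\<lambda>i. complex_of_real (d i)) * mat_adjoint U \<and>
     L = U * mat_diag (dim_row \<rho>) (\<lambda>i. complex_of_real (ln (d i))) * mat_adjoint U"
    unfolding dim by blast
  from someI_ex[OF this] obtain U d where Ud: "unitary_mat N U"
    "\<rho> = U * ?D d * mat_adjoint U" "L = U * ?D (\<lambda>i. ln (d i)) * mat_adjoint U"
    unfolding L_def hermitian_calculus_def using \<rho> by auto
  have U: "U \<in> carrier_mat N N" "mat_adjoint U * U = 1\<^sub>m N" using Ud(1) by (auto simp: unitary_mat_def)
  note Ua = mat_adjoint_carrier[OF U(1)]
  have D: "?D f \<in> carrier_mat N N" for f by simp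
  have cancel: "X * mat_adjoint U * U = X" if "X \<in> carrier_mat N N" for X
    using that U Ua by (simp add: assoc_mult_mat[OF that Ua U(1)])
  have \<rho>U: "\<rho> * U = U * ?D d"
    unfolding Ud(2) by (rule cancel[OF mult_carrier_mat[OF U(1) D]])
  define u where "u j i = U $$ (i, j)" for j i
  have "apply_op N (\<lambda>i l. \<rho> $$ (i, l)) (u j) i = complex_of_real (d j) * u j i"
    if ij: "j < N" "i < N" for j i
  proof -
    have "apply_op N (\<lambda>i l. \<rho> $$ (i, l)) (u j) i = (\<rho> * U) $$ (i, j)"
      using ij U \<rho> by (auto simp: scalar_prod_def apply_op_def u_def
          atLeast0LessThan intro!: sum.cong)
    also have "\<dots> = complex_of_real (d j) * u j i"
      unfolding \<rho>U using ij by (simp add: mat_diag_mult_right[OF U(1)] u_def)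
    finally show ?thesis .
  qed
  moreover have "orthonormal_upto N N u"
    using unitary_cols_orthonormal[OF Ud(1)] by (simp add: u_def[abs_def])
  moreover have "mat_trace (\<rho> * L) = complex_of_real (\<Sum>j<N. d j * ln (d j))"
  proof -
    let ?D' = "?D (\<lambda>i. ln (d i))"
    have "\<rho> * L = \<rho> * (U * ?D') * mat_adjoint U"
      unfolding Ud(3) by (rule assoc_mult_mat[OF \<rho> mult_carrier_mat[OF U(1) D] Ua, symmetric])
    also have "\<rho> * (U * ?D') = U * (?D d * ?D')"
      unfolding assoc_mult_mat[OF \<rho> U(1) D, symmetric] \<rho>U by (rule assoc_mult_mat[OF U(1) D D])
    finally have "mat_trace (\<rho> * L) = mat_trace (mat_adjoint U * (U * (?D d * ?D')))"
      by (simp only: mat_trace_comm[OF mult_carrier_mat[OF U(1) mult_carrier_mat[OF D D]] Ua])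
    also have "mat_adjoint U * (U * (?D d * ?D')) = ?D d * ?D'"
      unfolding assoc_mult_mat[OF Ua U(1) mult_carrier_mat[OF D D], symmetric] U(2)
      by (rule left_mult_one_mat[OF mult_carrier_mat[OF D D]])
    finally show ?thesis unfolding mat_diag_diag by (simp add: mat_trace_def mat_diag_def)
  qed
  ultimately show ?thesis using that[of u d] by (simp add: von_neumann_entropy_def L_def)
qed

section \<open>Entropy of density matrices close to low rank\<close>

lemma parseval_upto:
  assumes "orthonormal_upto N N u"
  shows "(\<Sum>j<N. (cmod (inner_upto N (u j) v))\<^sup>2) = (\<Sum>i<N. (cmod (v i))\<^sup>2)"
proof -
  have "complex_of_real (\<Sum>i<N. (cmod (v i))\<^sup>2) = inner_upto N v v"
    by (simp add: inner_upto_self)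
  also have "\<dots> = inner_upto N v (\<lambda>i. \<Sum>j<N. inner_upto N (u j) v * u j i)"
    unfolding inner_upto_def[of N v]
    by (intro sum.cong refl) (metis assms orthonormal_upto_expand lessThan_iff)
  also have "\<dots> = (\<Sum>j<N. inner_upto N (u j) v * inner_upto N v (u j))"
    by (simp only: inner_upto_sum_right inner_upto_scale_right)
  also have "\<dots> = (\<Sum>j<N. complex_of_real ((cmod (inner_upto N (u j) v))\<^sup>2))"
    by (intro sum.cong refl) (metis inner_upto_commute complex_norm_square)
  finally have "complex_of_real (\<Sum>i<N. (cmod (v i))\<^sup>2)
      = complex_of_real (\<Sum>j<N. (cmod (inner_upto N (u j) v))\<^sup>2)"
    by (simp only: of_real_sum)
  then show ?thesis by (simp only: of_real_eq_iff)
qed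

lemma inner_upto_sum_left:
  "inner_upto N (\<lambda>i. \<Sum>k\<in>K. c k * f k i) v = (\<Sum>k\<in>K. cnj (c k) * inner_upto N (f k) v)"
  unfolding inner_upto_def cnj_sum sum_distrib_left sum_distrib_right
  by (subst sum.swap) (simp add: mult_ac)

lemma inner_upto_cauchy_schwarz:
  "(cmod (inner_upto N x v))\<^sup>2 \<le> (\<Sum>i<N. (cmod (x i))\<^sup>2) * (\<Sum>i<N. (cmod (v i))\<^sup>2)"
proof -
  have "cmod (inner_upto N x v) \<le> (\<Sum>i<N. cmod (x i) * cmod (v i))"
    unfolding inner_upto_def by (rule order.trans[OF norm_sum]) (simp add: norm_mult)
  then have "(cmod (inner_upto N x v))\<^sup>2 \<le> (\<Sum>i<N. cmod (x i) * cmod (v i))\<^sup>2"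
    by (intro power_mono) auto
  also have "\<dots> \<le> (\<Sum>i<N. (cmod (x i))\<^sup>2) * (\<Sum>i<N. (cmod (v i))\<^sup>2)"
    by (rule Cauchy_Schwarz_ineq_sum)
  finally show ?thesis .
qed

text \<open>An entropy summand is small for a small eigenvalue, whereas the at most \<open>r\<close> large
  eigenvalues are compared with the uniform distribution on \<open>r\<close> points.\<close>

lemma entropy_sum_bound:
  fixes d :: "nat \<Rightarrow> real"
  assumes nonneg: "\<And>j. j < N \<Longrightarrow> d j \<ge> 0" and total: "(\<Sum>j<N. d j) = 1"
    and r: "r \<ge> 1" and \<epsilon>: "\<epsilon> \<ge> 0"
    and few: "card {j. j < N \<and> d j > \<epsilon>\<^sup>2} \<le> r"
  shows "- (\<Sum>j<N. d j * ln (d j)) \<le> ln (real r) + 1 + 2 * real N * \<epsilon>"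
proof -
  define I where "I = {j. j < N \<and> d j > \<epsilon>\<^sup>2}"
  have I: "I \<subseteq> {..<N}" "finite I" "card I \<le> r" using few by (auto simp: I_def)
  have dI: "d j > 0" if "j \<in> I" for j
  proof -
    have "\<epsilon>\<^sup>2 < d j" using that by (simp add: I_def)
    then show ?thesis using zero_le_power2[of \<epsilon>] by linarith
  qed
  have sI: "(\<Sum>j\<in>I. d j) \<le> 1"
    unfolding total[symmetric] by (rule sum_mono2) (use I nonneg in auto)
  have "(\<Sum>j\<in>I. - (d j * ln (d j))) \<le> (\<Sum>j\<in>I. d j * ln (real r) + 1 / real r)"
  proof (rule sum_mono)
    fix j assume j: "j \<in> I"
    note d = dI[OF j]
    \<comment> \<open>The inequality ln x <= x - 1, at the ratio of the uniform weight
      \<open>1 / real r\<close> to \<open>d j\<close>, is Gibbs' inequality term by term. The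
      leftover \<open>1 / real r\<close>, summed over at most \<open>r\<close> indices, is the
      constant 1 in the bound.\<close>
    have "ln (1 / (d j * real r)) \<le> 1 / (d j * real r) - 1"
      by (rule ln_le_minus_one) (use d r in simp)
    also have "\<dots> \<le> 1 / (d j * real r)" by simp
    also have "ln (1 / (d j * real r)) = - ln (d j) - ln (real r)"
      using d r by (simp add: ln_div ln_mult)
    finally have "d j * (- ln (d j) - ln (real r)) \<le> d j * (1 / (d j * real r))"
      using d by (intro mult_left_mono) auto
    then show "- (d j * ln (d j)) \<le> d j * ln (real r) + 1 / real r"
      using d by (simp add: algebra_simps)
  qed
  also have "\<dots> = (\<Sum>j\<in>I. d j) * ln (real r) + card I / real r"
    by (simp add: sum.distrib sum_distrib_right)
  also have "\<dots> \<le> 1 * ln (real r) + 1"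
    by (intro add_mono mult_right_mono sI) (use r I in \<open>auto simp: divide_le_eq\<close>)
  finally have 1: "(\<Sum>j\<in>I. - (d j * ln (d j))) \<le> ln (real r) + 1" by simp
  have "(\<Sum>j\<in>{..<N} - I. - (d j * ln (d j))) \<le> (\<Sum>j\<in>{..<N} - I. 2 * \<epsilon>)"
  proof (rule sum_mono)
    fix j assume j: "j \<in> {..<N} - I"
    then have d: "d j \<ge> 0" "d j \<le> \<epsilon>\<^sup>2" using nonneg by (auto simp: I_def)
    show "- (d j * ln (d j)) \<le> 2 * \<epsilon>"
    proof (cases "d j = 0")
      case False
      \<comment> \<open>Passing to the square root turns -d ln d into 2 q^2 (-ln q), which is at
        most 2 q. This is why the threshold for eigenvalues is \<open>\<epsilon>\<^sup>2\<close>
        while the bound is linear in \<open>\<epsilon>\<close>.\<close>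
      define q where "q = sqrt (d j)"
      have q: "q > 0" "d j = q\<^sup>2" "q \<le> \<epsilon>"
        using False d \<epsilon> real_le_lsqrt by (auto simp: q_def)
      have "- ln q = ln (1 / q)" using q by (simp add: ln_div)
      also have "\<dots> \<le> 1 / q - 1" by (rule ln_le_minus_one) (use q in simp)
      finally have "q\<^sup>2 * (- ln q) \<le> q\<^sup>2 * (1 / q)" by (intro mult_left_mono) auto
      then have "- (q\<^sup>2 * ln q) \<le> q" using q by (simp add: power2_eq_square)
      moreover have "- (d j * ln (d j)) = 2 * (- (q\<^sup>2 * ln q))"
        using q by (simp add: ln_realpow)
      ultimately show ?thesis using q by linarith
    qed (use \<epsilon> in simp)
  qed
  also have "\<dots> \<le> (\<Sum>j<N. 2 * \<epsilon>)" by (rule sum_mono2) (use \<epsilon> in auto)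
  finally have 2: "(\<Sum>j\<in>{..<N} - I. - (d j * ln (d j))) \<le> 2 * real N * \<epsilon>" by simp
  have "- (\<Sum>j<N. d j * ln (d j)) = (\<Sum>j\<in>I. - (d j * ln (d j))) + (\<Sum>j\<in>{..<N} - I. - (d j * ln (d j)))"
    using sum.subset_diff[OF I(1), of "\<lambda>j. d j * ln (d j)"] by (simp add: sum_negf)
  then show ?thesis using 1 2 by linarith
qed

text \<open>More than \<open>r\<close> eigenvectors with large eigenvalues would span a vector orthogonal to all
  \<open>r\<close> columns of the approximation, on which \<open>\<rho>\<close> is small.\<close>

lemma entropy_low_rank:
  fixes M :: "nat \<Rightarrow> 't \<Rightarrow> complex"
  assumes \<rho>: "\<rho> = Matrix.mat N N (\<lambda>(i, j). \<Sum>t\<in>T. M i t * cnj (M j t))" and T: "finite T"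
    and normalized: "(\<Sum>i<N. \<Sum>t\<in>T. (cmod (M i t))\<^sup>2) = 1"
    and r: "r \<ge> 1" and \<epsilon>: "\<epsilon> \<ge> 0" "real N * real (card T) * \<delta>\<^sup>2 \<le> \<epsilon>\<^sup>2"
    and approx: "\<And>i t. i < N \<Longrightarrow> t \<in> T \<Longrightarrow> cmod (M i t - (\<Sum>k<r. \<alpha> k i * \<beta> k t)) \<le> \<delta>"
  shows "von_neumann_entropy \<rho> \<le> ln (real r) + 1 + 2 * real N * \<epsilon>"
proof -
  let ?R = "\<lambda>i l. \<rho> $$ (i, l)"
  let ?col = "\<lambda>t i. M i t"
  have \<rho>c: "\<rho> \<in> carrier_mat N N" by (simp add: \<rho>)
  have herm: "?R j i = cnj (?R i j)" if "i < N" "j < N" for i j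
    using that by (simp add: \<rho> mult.commute)
  obtain u d where u: "orthonormal_upto N N u"
    and eig: "\<And>j i. j < N \<Longrightarrow> i < N \<Longrightarrow> apply_op N ?R (u j) i = complex_of_real (d j) * u j i"
    and S: "von_neumann_entropy \<rho> = - (\<Sum>j<N. d j * ln (d j))"
    by (rule von_neumann_entropy_eigenvalues[OF \<rho>c]) ((rule herm; assumption) | blast)+
  \<comment> \<open>\<open>\<rho>\<close> is \<open>M\<close> times its adjoint, so its quadratic
    form is the sum of the squared overlaps with the columns of \<open>M\<close>.\<close>
  have quad: "inner_upto N x (apply_op N ?R x)
      = complex_of_real (\<Sum>t\<in>T. (cmod (inner_upto N x (?col t)))\<^sup>2)" for x
  proof -
    have "inner_upto N x (apply_op N ?R x)
        = (\<Sum>i<N. \<Sum>l<N. \<Sum>t\<in>T. (cnj (x i) * M i t) * (x l * cnj (M l t)))"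
      unfolding inner_upto_def apply_op_def sum_distrib_left
      by (intro sum.cong refl) (simp add: \<rho> sum_distrib_left sum_distrib_right mult_ac)
    also have "\<dots> = (\<Sum>i<N. \<Sum>t\<in>T. \<Sum>l<N. (cnj (x i) * M i t) * (x l * cnj (M l t)))"
      by (intro sum.cong refl sum.swap)
    also have "\<dots> = (\<Sum>t\<in>T. \<Sum>i<N. \<Sum>l<N. (cnj (x i) * M i t) * (x l * cnj (M l t)))"
      by (rule sum.swap)
    also have "\<dots> = (\<Sum>t\<in>T. inner_upto N x (?col t) * cnj (inner_upto N x (?col t)))"
      by (simp add: inner_upto_def sum_product)
    finally show ?thesis by (simp only: of_real_sum complex_norm_square)
  qed
  have d: "d j = (\<Sum>t\<in>T. (cmod (inner_upto N (u j) (?col t)))\<^sup>2)" if "j < N" for j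
  proof -
    have "inner_upto N (u j) (apply_op N ?R (u j)) = inner_upto N (u j) (\<lambda>i. complex_of_real (d j) * u j i)"
      unfolding inner_upto_def by (intro sum.cong refl) (simp add: eig[OF that])
    also have "\<dots> = complex_of_real (d j)"
      unfolding inner_upto_scale_right using u that by (simp add: orthonormal_upto_def)
    finally show ?thesis unfolding quad of_real_eq_iff by simp
  qed
  have nonneg: "d j \<ge> 0" if "j < N" for j unfolding d[OF that] by (intro sum_nonneg) auto
  have "(\<Sum>j<N. d j) = (\<Sum>t\<in>T. \<Sum>j<N. (cmod (inner_upto N (u j) (?col t)))\<^sup>2)"
    by (subst sum.swap) (simp add: d)
  also have "\<dots> = (\<Sum>i<N. \<Sum>t\<in>T. (cmod (M i t))\<^sup>2)"
    by (subst sum.swap) (simp add: parseval_upto[OF u])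
  finally have total: "(\<Sum>j<N. d j) = 1" using normalized by simp
  have "card {j. j < N \<and> d j > \<epsilon>\<^sup>2} \<le> r"
  proof (rule ccontr)
    define I where "I = {j. j < N \<and> d j > \<epsilon>\<^sup>2}"
    assume "\<not> ?thesis"
    then have I: "finite I" "r < card I" "I \<subseteq> {..<N}" by (auto simp: I_def)
    \<comment> \<open>Orthogonality of \<open>x\<close> to \<open>\<alpha> k\<close> is
      conjugate-linear in the coefficients of \<open>x\<close>; its complex conjugate is a linear
      equation for \<open>c\<close>.\<close>
    obtain c where c: "\<exists>j\<in>I. c j \<noteq> 0"
      "\<forall>k<r. (\<Sum>j\<in>I. cnj (inner_upto N (u j) (\<alpha> k)) * c j) = 0"
      using underdetermined_system[OF I(1,2), of "\<lambda>k j. cnj (inner_upto N (u j) (\<alpha> k))"] by auto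
    define x where "x i = (\<Sum>j\<in>I. c j * u j i)" for i
    have xalpha: "inner_upto N x (\<alpha> k) = 0" if "k < r" for k
    proof -
      have "inner_upto N x (\<alpha> k) = cnj (\<Sum>j\<in>I. cnj (inner_upto N (u j) (\<alpha> k)) * c j)"
        unfolding x_def inner_upto_sum_left by (simp add: mult.commute)
      then show ?thesis using c(2) that by simp
    qed
    have ux: "inner_upto N (u j) x = (if j \<in> I then c j else 0)" if "j < N" for j
    proof -
      have "inner_upto N (u j) x = (\<Sum>l\<in>I. c l * inner_upto N (u j) (u l))"
        unfolding x_def inner_upto_sum_right by (simp add: inner_upto_scale_right)
      also have "\<dots> = (\<Sum>l\<in>I. if j = l then c l else 0)"
        using u that I(3) by (intro sum.cong refl) (auto simp: orthonormal_upto_def)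
      also have "\<dots> = (if j \<in> I then c j else 0)" using I(1) by simp
      finally show ?thesis .
    qed
    have xx: "(\<Sum>i<N. (cmod (x i))\<^sup>2) = (\<Sum>j\<in>I. (cmod (c j))\<^sup>2)"
    proof -
      have "(\<Sum>i<N. (cmod (x i))\<^sup>2) = (\<Sum>j<N. (cmod (inner_upto N (u j) x))\<^sup>2)"
        by (simp add: parseval_upto[OF u])
      also have "\<dots> = (\<Sum>j\<in>I. (cmod (c j))\<^sup>2)"
        using I by (intro sum.mono_neutral_cong_right) (auto simp: ux)
      finally show ?thesis .
    qed
    have "inner_upto N x (apply_op N ?R x) = complex_of_real (\<Sum>j\<in>I. d j * (cmod (c j))\<^sup>2)"
    proof -
      have "apply_op N ?R x i = (\<Sum>j\<in>I. (c j * complex_of_real (d j)) * u j i)" if "i < N" for i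
        unfolding x_def apply_op_sum using I(3) that
        by (intro sum.cong refl) (auto simp: apply_op_scale eig)
      then have "inner_upto N x (apply_op N ?R x)
          = inner_upto N x (\<lambda>i. \<Sum>j\<in>I. (c j * complex_of_real (d j)) * u j i)"
        unfolding inner_upto_def by (intro sum.cong refl) simp
      also have "\<dots> = (\<Sum>j\<in>I. c j * complex_of_real (d j) * cnj (inner_upto N (u j) x))"
        unfolding inner_upto_sum_right inner_upto_scale_right by (simp flip: inner_upto_commute)
      also have "\<dots> = (\<Sum>j\<in>I. complex_of_real (d j * (cmod (c j))\<^sup>2))"
        using I(3) by (intro sum.cong refl) (auto simp: ux mult_ac simp flip: complex_norm_square)
      finally show ?thesis by simp
    qed
    then have dx: "(\<Sum>j\<in>I. d j * (cmod (c j))\<^sup>2) = (\<Sum>t\<in>T. (cmod (inner_upto N x (?col t)))\<^sup>2)"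
      unfolding quad of_real_eq_iff by simp
    \<comment> \<open>The quadratic form at \<open>x\<close> is now estimated twice: strictly from
      below, since all eigenvalues in \<open>I\<close> exceed \<open>\<epsilon>\<^sup>2\<close> and
      \<open>c\<close> is nonzero, and from above, since \<open>x\<close> annihilates the low-rank
      part and meets only the error \<open>E\<close> of each column.\<close>
    have "\<epsilon>\<^sup>2 * (\<Sum>j\<in>I. (cmod (c j))\<^sup>2) < (\<Sum>j\<in>I. d j * (cmod (c j))\<^sup>2)"
      unfolding sum_distrib_left
      by (rule sum_strict_mono_ex1) (use I(1) c(1) in \<open>auto simp: I_def mult_right_mono\<close>)
    also have "\<dots> \<le> (\<Sum>t\<in>T. (\<Sum>j\<in>I. (cmod (c j))\<^sup>2) * (real N * \<delta>\<^sup>2))"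
      unfolding dx
    proof (rule sum_mono)
      fix t assume t: "t \<in> T"
      define E where "E i = M i t - (\<Sum>k<r. \<alpha> k i * \<beta> k t)" for i
      have "inner_upto N x (?col t) = inner_upto N x (\<lambda>i. E i + (\<Sum>k<r. \<beta> k t * \<alpha> k i))"
        by (simp add: E_def mult.commute)
      also have "\<dots> = inner_upto N x E + inner_upto N x (\<lambda>i. \<Sum>k<r. \<beta> k t * \<alpha> k i)"
        by (simp add: inner_upto_def algebra_simps sum.distrib)
      also have "inner_upto N x (\<lambda>i. \<Sum>k<r. \<beta> k t * \<alpha> k i) = 0"
        unfolding inner_upto_sum_right inner_upto_scale_right by (simp add: xalpha)
      finally have "(cmod (inner_upto N x (?col t)))\<^sup>2
          \<le> (\<Sum>i<N. (cmod (x i))\<^sup>2) * (\<Sum>i<N. (cmod (E i))\<^sup>2)"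
        using inner_upto_cauchy_schwarz[of N x E] by simp
      also have "\<dots> \<le> (\<Sum>i<N. (cmod (x i))\<^sup>2) * (\<Sum>i<N. \<delta>\<^sup>2)"
        using approx t by (intro mult_left_mono sum_mono power_mono sum_nonneg) (auto simp: E_def)
      finally show "(cmod (inner_upto N x (?col t)))\<^sup>2
          \<le> (\<Sum>j\<in>I. (cmod (c j))\<^sup>2) * (real N * \<delta>\<^sup>2)"
        by (simp add: xx)
    qed
    also have "\<dots> = (real N * real (card T) * \<delta>\<^sup>2) * (\<Sum>j\<in>I. (cmod (c j))\<^sup>2)" by simp
    also have "\<dots> \<le> \<epsilon>\<^sup>2 * (\<Sum>j\<in>I. (cmod (c j))\<^sup>2)"
      by (intro mult_right_mono \<epsilon> sum_nonneg) auto
    finally show False by simp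
  qed
  then show ?thesis unfolding S by (intro entropy_sum_bound nonneg total r \<epsilon>) auto
qed

section \<open>Polynomial approximation on an interval\<close>

text \<open>The identity holds for complex \<open>w\<close>, so one formula yields both the bound on
  the interval, where \<open>w\<close> is real, and the growth away from it, where
  \<open>w = Arccos z\<close>. The induction carries two consecutive polynomials for the three-term
  recurrence.\<close>

lemma chebyshev_polynomial:
  obtains p :: "complex poly" where "degree p \<le> n" "\<And>w. poly p (cos w) = cos (of_nat n * w)"
proof -
  have "\<exists>p q :: complex poly. degree p \<le> n \<and> degree q \<le> Suc n \<and>
      (\<forall>w. poly p (cos w) = cos (of_nat n * w) \<and> poly q (cos w) = cos (of_nat (Suc n) * w))"
  proof (induction n)
    case 0
    show ?case by (intro exI[of _ 1] exI[of _ "[:0, 1:]"]) auto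
  next
    case (Suc n)
    then obtain p q :: "complex poly" where pq: "degree p \<le> n" "degree q \<le> Suc n"
      "\<And>w. poly p (cos w) = cos (of_nat n * w)" "\<And>w. poly q (cos w) = cos (of_nat (Suc n) * w)"
      by blast
    have "degree ([:0, 2:] * q - p) \<le> Suc (Suc n)"
    proof (rule degree_diff_le)
      show "degree ([:0, 2:] * q) \<le> Suc (Suc n)"
        using degree_mult_le[of "[:0, 2:]" q] pq(2) by simp
    qed (use pq(1) in simp)
    moreover have "poly ([:0, 2:] * q - p) (cos w) = cos (of_nat (Suc (Suc n)) * w)" for w
    proof -
      have "cos (of_nat (Suc (Suc n)) * w) + cos (of_nat n * w)
          = cos (of_nat (Suc n) * w + w) + cos (of_nat (Suc n) * w - w)"
        by (simp add: algebra_simps)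
      also have "\<dots> = 2 * cos w * cos (of_nat (Suc n) * w)" by (simp add: cos_add cos_diff)
      finally show ?thesis by (simp add: pq(3,4) algebra_simps del: of_nat_Suc)
    qed
    ultimately show ?case using pq by blast
  qed
  then show ?thesis using that by blast
qed

text \<open>Dropping the cosine on the right bounds the modulus from below by the hyperbolic sine of
  the imaginary part alone, whatever the real part is.\<close>

lemma norm_cos_complex_sq:
  "(cmod (cos z))\<^sup>2 = (cos (Re z))\<^sup>2 + (sinh (Im z))\<^sup>2"
proof -
  have "(cmod (cos z))\<^sup>2 = (cos (Re z))\<^sup>2 * (cosh (Im z))\<^sup>2 + (sin (Re z))\<^sup>2 * (sinh (Im z))\<^sup>2"
    unfolding cmod_power2
    by (simp add: Re_cos Im_cos cosh_field_def sinh_field_def power_mult_distrib power2_eq_square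
        field_simps)
  also have "\<dots> = (cos (Re z))\<^sup>2 + ((sin (Re z))\<^sup>2 + (cos (Re z))\<^sup>2) * (sinh (Im z))\<^sup>2"
    unfolding cosh_square_eq by (simp only: algebra_simps)
  finally show ?thesis by simp
qed

lemma sinh_nat_mult_ge:
  fixes b :: real
  assumes "b \<ge> 0"
  shows "sinh (of_nat n * b) \<ge> (exp b ^ n - 1) / 2"
proof -
  have "sinh (real n * b) = (exp b ^ n - exp (- (real n * b))) / 2"
    by (simp add: sinh_field_def exp_of_nat_mult)
  moreover have "exp (- (real n * b)) \<le> 1" using assms by simp
  ultimately show ?thesis by simp
qed

text \<open>On the contour used below the Chebyshev polynomial is exponentially large: every
  \<open>z = cos w\<close> there has \<open>\<bar>Im w\<bar> \<ge> arsinh \<delta>\<close>.\<close>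

lemma chebyshev_outside:
  assumes p: "\<And>w. poly p (cos w) = cos (of_nat n * w)"
    and \<delta>: "\<delta> > 0" and z: "\<bar>Im z\<bar> \<ge> \<delta> \<or> \<bar>Re z\<bar> \<ge> 1 + \<delta>"
  shows "cmod (poly p z) \<ge> sinh (real n * arsinh \<delta>)"
proof -
  define w where "w = Arccos z"
  have zw: "z = cos w" by (simp add: w_def)
  have Re: "Re z = cos (Re w) * cosh (Im w)" and Im: "Im z = - (sin (Re w) * sinh (Im w))"
    unfolding zw by (simp_all add: Re_cos Im_cos cosh_field_def sinh_field_def field_simps)
  have sq: "(sinh (Im w))\<^sup>2 \<ge> \<delta>\<^sup>2"
    using z
  proof
    assume "\<bar>Im z\<bar> \<ge> \<delta>"
    also have "\<bar>Im z\<bar> \<le> \<bar>sinh (Im w)\<bar>"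
      unfolding Im abs_minus_cancel abs_mult by (rule mult_left_le_one_le) auto
    finally show ?thesis using \<delta> by (simp add: abs_le_square_iff[symmetric])
  next
    assume "\<bar>Re z\<bar> \<ge> 1 + \<delta>"
    also have "\<bar>Re z\<bar> \<le> \<bar>cosh (Im w)\<bar>"
      unfolding Re abs_mult by (rule mult_left_le_one_le) auto
    finally have "(1 + \<delta>)\<^sup>2 \<le> (cosh (Im w))\<^sup>2"
      using \<delta> by (simp add: abs_le_square_iff[symmetric])
    then have "1 + 2 * \<delta> + \<delta>\<^sup>2 \<le> (sinh (Im w))\<^sup>2 + 1"
      unfolding cosh_square_eq by (simp add: power2_eq_square algebra_simps)
    then show ?thesis using \<delta> by linarith
  qed
  then have "\<delta> \<le> sinh \<bar>Im w\<bar>"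
    using \<delta> by (simp add: sinh_real_abs abs_le_square_iff[symmetric])
  then have "arsinh \<delta> \<le> \<bar>Im w\<bar>"
    using sinh_real_le_iff[of "arsinh \<delta>" "\<bar>Im w\<bar>"] by simp
  then have "sinh (real n * arsinh \<delta>) \<le> sinh (real n * \<bar>Im w\<bar>)"
    by (simp add: mult_left_mono)
  also have "\<dots> = \<bar>sinh (real n * Im w)\<bar>"
    by (simp add: sinh_real_abs[symmetric] abs_mult)
  also have "\<dots> \<le> cmod (cos (of_nat n * w))"
  proof -
    have "(sinh (real n * Im w))\<^sup>2 \<le> (cmod (cos (of_nat n * w)))\<^sup>2"
      unfolding norm_cos_complex_sq by simp
    then show ?thesis by (simp add: abs_le_square_iff[symmetric])
  qed
  finally show ?thesis by (simp add: zw p)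
qed

lemma chebyshev_inside:
  assumes "\<And>w. poly p (cos w) = cos (of_nat n * w)" "x \<in> {-1..1}"
  shows "cmod (poly p (complex_of_real x)) \<le> 1"
proof -
  have "complex_of_real x = cos (complex_of_real (arccos x))"
    using assms(2) by (simp add: cos_of_real)
  then have "poly p (complex_of_real x) = complex_of_real (cos (real n * arccos x))"
    using assms(1) by (simp flip: cos_of_real)
  then show ?thesis by (simp only: norm_of_real) simp
qed

text \<open>The quotient is sorted by powers of \<open>x\<close>, and the coefficients
  \<open>q k\<close> are fixed before \<open>x\<close> and \<open>z\<close>. Integrated over
  \<open>z\<close>, they become the coefficients of the approximating polynomial in
  \<open>x\<close>, whose degree is thereby below that of \<open>\<omega>\<close>.\<close>

lemma polynomial_divided_difference:
  fixes \<omega> :: "complex poly"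
  obtains q where "\<And>x z. poly \<omega> z - poly \<omega> x = (z - x) * (\<Sum>k<degree \<omega>. x ^ k * poly (q k) z)"
proof -
  define q where "q k = (\<Sum>i\<in>{k<..degree \<omega>}. monom (coeff \<omega> i) (i - Suc k))" for k
  have "poly \<omega> z - poly \<omega> x = (z - x) * (\<Sum>k<degree \<omega>. x ^ k * poly (q k) z)" for x z
  proof -
    have pow: "z ^ i - x ^ i = (z - x) * (\<Sum>k<i. z ^ (i - Suc k) * x ^ k)" for i
    proof -
      have "z ^ i - x ^ i = - ((x - z) * (\<Sum>k<i. z ^ (i - Suc k) * x ^ k))"
        by (simp flip: power_diff_sumr2)
      then show ?thesis by (simp flip: mult_minus_left)
    qed
    have "poly \<omega> z - poly \<omega> x = (\<Sum>i\<le>degree \<omega>. coeff \<omega> i * (z ^ i - x ^ i))"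
      by (simp add: poly_altdef sum_subtractf algebra_simps)
    also have "\<dots> = (\<Sum>i\<le>degree \<omega>. coeff \<omega> i * ((z - x) * (\<Sum>k<i. z ^ (i - Suc k) * x ^ k)))"
      by (simp only: pow)
    also have "\<dots> = (z - x) * (\<Sum>i\<le>degree \<omega>. \<Sum>k<i. x ^ k * (coeff \<omega> i * z ^ (i - Suc k)))"
      by (simp add: sum_distrib_left mult_ac)
    also have "(\<Sum>i\<le>degree \<omega>. \<Sum>k<i. x ^ k * (coeff \<omega> i * z ^ (i - Suc k)))
        = (\<Sum>(i, k)\<in>Sigma {..degree \<omega>} (\<lambda>i. {..<i}). x ^ k * (coeff \<omega> i * z ^ (i - Suc k)))"
      by (rule sum.Sigma) auto
    also have "\<dots> = (\<Sum>(k, i)\<in>Sigma {..<degree \<omega>} (\<lambda>k. {k<..degree \<omega>}).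
        x ^ k * (coeff \<omega> i * z ^ (i - Suc k)))"
      by (rule sum.reindex_bij_witness[of _ "\<lambda>(k, i). (i, k)" "\<lambda>(i, k). (k, i)"]) auto
    also have "\<dots> = (\<Sum>k<degree \<omega>. \<Sum>i\<in>{k<..degree \<omega>}. x ^ k * (coeff \<omega> i * z ^ (i - Suc k)))"
      by (rule sum.Sigma[symmetric]) auto
    also have "\<dots> = (\<Sum>k<degree \<omega>. x ^ k * poly (q k) z)"
      by (simp add: q_def poly_sum poly_monom sum_distrib_left)
    finally show ?thesis .
  qed
  then show ?thesis using that by blast
qed

section \<open>Approximation on Bernstein ellipses\<close>

lemma open_bernstein_ellipse:
  assumes "a > 0"
  shows "open (bernstein_ellipse a)"
  unfolding bernstein_ellipse_def using assms
  by (intro open_Collect_less continuous_intros) auto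

lemma convex_bernstein_ellipse: "convex (bernstein_ellipse a)"
proof -
  let ?f = "\<lambda>z. Complex (Re z / cosh a) (Im z / sinh a)"
  have "linear ?f" by (rule linearI) (auto simp: complex_eq_iff add_divide_distrib)
  then have "convex (?f -` ball 0 1)" by (rule convex_linear_vimage) simp
  moreover have "?f -` ball 0 1 = bernstein_ellipse a"
    by (auto simp: bernstein_ellipse_def cmod_def power_divide)
  ultimately show ?thesis by simp
qed

lemma bernstein_ellipse_mono:
  assumes "0 < a" "a \<le> a'"
  shows "bernstein_ellipse a \<subseteq> bernstein_ellipse a'"
proof
  fix z assume z: "z \<in> bernstein_ellipse a"
  have "(Re z)\<^sup>2 / (cosh a')\<^sup>2 \<le> (Re z)\<^sup>2 / (cosh a)\<^sup>2"
    using assms by (intro divide_left_mono power_mono mult_pos_pos) (auto simp: cosh_real_nonneg_le_iff)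
  moreover have "(Im z)\<^sup>2 / (sinh a')\<^sup>2 \<le> (Im z)\<^sup>2 / (sinh a)\<^sup>2"
    using assms by (intro divide_left_mono power_mono mult_pos_pos) auto
  ultimately show "z \<in> bernstein_ellipse a'" using z by (simp add: bernstein_ellipse_def)
qed

lemma real_interval_subset_bernstein_ellipse:
  assumes "0 < a" "x \<in> {-1..1}"
  shows "complex_of_real x \<in> bernstein_ellipse a"
proof -
  have "1 < cosh a" using cosh_real_nonneg_less_iff[of 0 a] assms(1) by simp
  then have "1 < (cosh a)\<^sup>2" by (simp add: power2_eq_square less_1_mult)
  moreover have "x\<^sup>2 \<le> 1" using assms(2) by (auto simp: abs_square_le_1)
  ultimately show ?thesis by (simp add: bernstein_ellipse_def)
qed

text \<open>By continuity as \<open>\<delta>\<close> tends to 0, because the endpoint 1 is an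
  interior point of the ellipse. The margin is twice \<open>\<delta>\<close> so that a contour along
  the boundary keeps room on its inner side.\<close>

lemma rectangle_in_bernstein_ellipse:
  assumes "a > 0"
  obtains \<delta> where "\<delta> > 0"
    "cbox (Complex (-1 - 2 * \<delta>) (-2 * \<delta>)) (Complex (1 + 2 * \<delta>) (2 * \<delta>)) \<subseteq> bernstein_ellipse a"
proof -
  have "((\<lambda>\<delta>. (1 + 2 * \<delta>)\<^sup>2 / (cosh a)\<^sup>2 + (2 * \<delta>)\<^sup>2 / (sinh a)\<^sup>2) \<longlongrightarrow>
      (1 + 2 * 0)\<^sup>2 / (cosh a)\<^sup>2 + (2 * 0)\<^sup>2 / (sinh a)\<^sup>2) (at_right 0)"
    using assms by (intro tendsto_intros) auto
  moreover have "(1 + 2 * 0)\<^sup>2 / (cosh a)\<^sup>2 + (2 * 0)\<^sup>2 / (sinh a)\<^sup>2 < 1"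
    using real_interval_subset_bernstein_ellipse[OF assms, of 1] by (simp add: bernstein_ellipse_def)
  ultimately have "\<forall>\<^sub>F \<delta> in at_right 0. (1 + 2 * \<delta>)\<^sup>2 / (cosh a)\<^sup>2 + (2 * \<delta>)\<^sup>2 / (sinh a)\<^sup>2 < 1"
    by (rule order_tendstoD(2))
  with eventually_at_right_less[of 0]
  have "\<forall>\<^sub>F \<delta> in at_right 0. 0 < \<delta> \<and> (1 + 2 * \<delta>)\<^sup>2 / (cosh a)\<^sup>2 + (2 * \<delta>)\<^sup>2 / (sinh a)\<^sup>2 < 1"
    by (rule eventually_conj)
  then obtain \<delta> where \<delta>: "0 < \<delta>" "(1 + 2 * \<delta>)\<^sup>2 / (cosh a)\<^sup>2 + (2 * \<delta>)\<^sup>2 / (sinh a)\<^sup>2 < 1"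
    using eventually_happens'[OF trivial_limit_at_right_real] by blast
  have "z \<in> bernstein_ellipse a"
    if "z \<in> cbox (Complex (-1 - 2 * \<delta>) (-2 * \<delta>)) (Complex (1 + 2 * \<delta>) (2 * \<delta>))" for z
  proof -
    have "\<bar>Re z\<bar> \<le> \<bar>1 + 2 * \<delta>\<bar>" "\<bar>Im z\<bar> \<le> \<bar>2 * \<delta>\<bar>" using that by (auto simp: in_cbox_complex_iff)
    then have "(Re z)\<^sup>2 \<le> (1 + 2 * \<delta>)\<^sup>2" "(Im z)\<^sup>2 \<le> (2 * \<delta>)\<^sup>2"
      unfolding abs_le_square_iff by auto
    then have "(Re z)\<^sup>2 / (cosh a)\<^sup>2 + (Im z)\<^sup>2 / (sinh a)\<^sup>2
        \<le> (1 + 2 * \<delta>)\<^sup>2 / (cosh a)\<^sup>2 + (2 * \<delta>)\<^sup>2 / (sinh a)\<^sup>2"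
      by (intro add_mono divide_right_mono) auto
    then show ?thesis using \<delta>(2) by (simp add: bernstein_ellipse_def)
  qed
  then show ?thesis using that[OF \<delta>(1)] by blast
qed

text \<open>Hermite's formula: splitting \<open>1 / (z - x)\<close> in Cauchy's integral as
  \<open>(\<omega> z - \<omega> x) / ((z - x) * \<omega> z) + \<omega> x / ((z - x) * \<omega> z)\<close>, the first part integrates to a
  polynomial in \<open>x\<close> and, for the Chebyshev polynomial \<open>\<omega>\<close>, the second part is exponentially
  small.\<close>

lemma bernstein_polynomial_approximation:
  assumes a: "a > 0"
  shows "\<exists>K>0. \<exists>R>1. \<forall>f M n. n \<ge> 1 \<longrightarrow> f holomorphic_on bernstein_ellipse a \<longrightarrow>
    (\<forall>z\<in>bernstein_ellipse a. cmod (f z) \<le> M) \<longrightarrow>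
    (\<exists>p. degree p < n \<and>
       (\<forall>x\<in>{-1..1}. cmod (f (complex_of_real x) - poly p (complex_of_real x)) \<le> K * M / R ^ n))"
proof -
  define S where "S = bernstein_ellipse a"
  note S = open_bernstein_ellipse[OF a, folded S_def] convex_bernstein_ellipse[of a, folded S_def]
  obtain \<delta> where \<delta>: "\<delta> > 0"
    "cbox (Complex (-1 - 2 * \<delta>) (-2 * \<delta>)) (Complex (1 + 2 * \<delta>) (2 * \<delta>)) \<subseteq> S"
    using rectangle_in_bernstein_ellipse[OF a] unfolding S_def by blast
  define c1 c2 where "c1 = Complex (-1 - 2 * \<delta>) (-2 * \<delta>)" and "c2 = Complex (1 + 2 * \<delta>) (2 * \<delta>)"
  define \<gamma> where "\<gamma> = rectpath c1 c2"
  \<comment> \<open>The contour runs at margin twice \<open>\<delta>\<close>, whereas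
    \<open>U\<close> begins at margin \<open>\<delta>\<close>. It is thus an open neighbourhood of
    the contour on which the integrand can be bounded, and the factor \<open>L\<close> depends only
    on \<open>U\<close> and the contour, not on the integrand.\<close>
  define U where "U = S \<inter> {z. \<bar>Im z\<bar> > \<delta> \<or> \<bar>Re z\<bar> > 1 + \<delta>}"
  have "open {z. \<bar>Im z\<bar> > \<delta> \<or> \<bar>Re z\<bar> > 1 + \<delta>}"
    by (intro open_Collect_disj open_Collect_less continuous_intros)
  then have U: "open U" "U \<subseteq> S" using S by (auto simp: U_def)
  have \<gamma>: "valid_path \<gamma>" "pathfinish \<gamma> = pathstart \<gamma>" by (simp_all add: \<gamma>_def)
  have \<gamma>U: "path_image \<gamma> \<subseteq> U"
  proof -
    have "path_image \<gamma> = cbox c1 c2 - box c1 c2"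
      unfolding \<gamma>_def by (rule path_image_rectpath_cbox_minus_box) (use \<delta> in \<open>auto simp: c1_def c2_def\<close>)
    then show ?thesis using \<delta>
      by (auto simp: U_def c1_def c2_def in_cbox_complex_iff in_box_complex_iff)
  qed
  obtain L where L: "L > 0"
    "\<And>f B. f holomorphic_on U \<Longrightarrow> (\<And>z. z \<in> U \<Longrightarrow> cmod (f z) \<le> B) \<Longrightarrow>
       cmod (contour_integral \<gamma> f) \<le> L * B"
    using contour_integral_bound_exists[OF U(1) \<gamma>(1) \<gamma>U] by blast
  define R where "R = exp (arsinh \<delta>)"
  have R: "R > 1" using \<delta>(1) by (simp add: R_def)
  \<comment> \<open>The product of \<open>L / (2 * pi)\<close> from Cauchy's formula,
    \<open>1 / \<delta>\<close> from the distance to \<open>x\<close>, and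
    \<open>2 / (1 - 1 / R)\<close> from the lower bound \<open>s\<close> for the Chebyshev
    polynomial.\<close>
  define K where "K = L / pi / \<delta> / (1 - 1 / R)"
  have K: "K > 0" unfolding K_def using L(1) \<delta>(1) R by (intro divide_pos_pos) auto
  have main: "\<exists>p. degree p < n \<and>
         (\<forall>x\<in>{-1..1}. cmod (f (complex_of_real x) - poly p (complex_of_real x)) \<le> K * M / R ^ n)"
    if n: "n \<ge> 1" and f: "f holomorphic_on S" and bound: "\<forall>z\<in>S. cmod (f z) \<le> M" for f M n
  proof -
    have M: "cmod (f z) \<le> M" if "z \<in> S" for z using bound that by blast
    obtain \<omega> :: "complex poly" where \<omega>: "degree \<omega> \<le> n" "\<And>w. poly \<omega> (cos w) = cos (of_nat n * w)"
      using chebyshev_polynomial by blast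
    \<comment> \<open>The available lower bound \<open>(R ^ n - 1) / 2\<close> is replaced by a pure
      multiple of \<open>R ^ n\<close>; this uses \<open>R \<le> R ^ n\<close>, hence
      \<open>n \<ge> 1\<close>.\<close>
    define s where "s = (1 - 1 / R) * R ^ n / 2"
    have s: "s > 0" using R by (simp add: s_def)
    have \<omega>U: "cmod (poly \<omega> z) \<ge> s" if "z \<in> U" for z
    proof -
      have "R ^ 1 \<le> R ^ n" using R n by (intro power_increasing) auto
      then have "1 \<le> R ^ n / R" using R by (simp add: field_simps)
      then have "(R ^ n - R ^ n / R) / 2 \<le> (R ^ n - 1) / 2" by (intro divide_right_mono diff_mono) auto
      then have "s \<le> (R ^ n - 1) / 2" by (simp add: s_def algebra_simps)
      also have "\<dots> \<le> sinh (real n * arsinh \<delta>)"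
        unfolding R_def using \<delta>(1) by (intro sinh_nat_mult_ge less_imp_le) simp
      also have "\<dots> \<le> cmod (poly \<omega> z)"
        by (rule chebyshev_outside[OF \<omega>(2) \<delta>(1)]) (use that in \<open>auto simp: U_def\<close>)
      finally show ?thesis .
    qed
    then have \<omega>0: "poly \<omega> z \<noteq> 0" if "z \<in> U" for z using s that by force
    obtain q where q: "\<And>x z. poly \<omega> z - poly \<omega> x = (z - x) * (\<Sum>k<degree \<omega>. x ^ k * poly (q k) z)"
      using polynomial_divided_difference by blast
    define c where "c k = contour_integral \<gamma> (\<lambda>z. f z * poly (q k) z / poly \<omega> z) / (2 * pi * \<i>)" for k
    define p where "p = (\<Sum>k<degree \<omega>. monom (c k) k)"
    have fU: "f holomorphic_on U" using f U(2) by (rule holomorphic_on_subset)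
    have hq: "(\<lambda>z. f z * poly (q k) z / poly \<omega> z) holomorphic_on U" for k
      using fU \<omega>0 by (intro holomorphic_intros) auto
    have "degree p < n" unfolding p_def using \<omega>(1) n
      by (intro degree_sum_less) (auto intro!: le_less_trans[OF degree_monom_le])
    moreover have "cmod (f (complex_of_real x) - poly p (complex_of_real x)) \<le> K * M / R ^ n"
      if x: "x \<in> {-1..1}" for x
    proof -
      let ?x = "complex_of_real x"
      have xbox: "?x \<in> box c1 c2" using x \<delta>(1) by (auto simp: c1_def c2_def in_box_complex_iff)
      have xS: "?x \<in> interior S"
        using real_interval_subset_bernstein_ellipse[OF a x] S(1) by (simp add: S_def interior_open)
      have zx: "cmod (z - ?x) \<ge> \<delta>" if "z \<in> U" for z
      proof -
        have "\<delta> \<le> \<bar>Im (z - ?x)\<bar> \<or> \<delta> \<le> \<bar>Re (z - ?x)\<bar>" using that x by (auto simp: U_def)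
        then show ?thesis using abs_Im_le_cmod[of "z - ?x"] abs_Re_le_cmod[of "z - ?x"] by linarith
      qed
      then have zx0: "z \<noteq> ?x" if "z \<in> U" for z using \<delta>(1) that by force
      let ?E = "\<lambda>z. f z * poly \<omega> ?x / (poly \<omega> z * (z - ?x))"
      have hE: "?E holomorphic_on U"
        using fU \<omega>0 zx0 by (intro holomorphic_intros) auto
      have "((\<lambda>z. f z / (z - ?x)) has_contour_integral 2 * pi * \<i> * winding_number \<gamma> ?x * f ?x) \<gamma>"
        by (rule Cauchy_integral_formula_convex_simple[OF S(2) f xS \<gamma>(1) _ \<gamma>(2)])
          (use \<gamma>U U zx0 in auto)
      then have "2 * pi * \<i> * f ?x = contour_integral \<gamma> (\<lambda>z. f z / (z - ?x))"
        using winding_number_rectpath[OF xbox] by (simp add: contour_integral_unique \<gamma>_def)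
      also have "\<dots> = contour_integral \<gamma>
          (\<lambda>z. (\<Sum>k<degree \<omega>. ?x ^ k * (f z * poly (q k) z / poly \<omega> z)) + ?E z)"
      proof (rule contour_integral_cong[OF refl])
        fix z assume "z \<in> path_image \<gamma>"
        then have z: "z \<in> U" using \<gamma>U by auto
        have "(\<Sum>k<degree \<omega>. ?x ^ k * (f z * poly (q k) z / poly \<omega> z))
            = f z / poly \<omega> z * (\<Sum>k<degree \<omega>. ?x ^ k * poly (q k) z)"
          by (simp add: sum_distrib_left mult_ac)
        also have "(\<Sum>k<degree \<omega>. ?x ^ k * poly (q k) z) = (poly \<omega> z - poly \<omega> ?x) / (z - ?x)"
          using q[of z ?x] zx0[OF z] by simp
        finally show "f z / (z - ?x)
            = (\<Sum>k<degree \<omega>. ?x ^ k * (f z * poly (q k) z / poly \<omega> z)) + ?E z"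
          using zx0[OF z] \<omega>0[OF z] by (simp add: field_simps)
      qed
      also have "\<dots> = (\<Sum>k<degree \<omega>. ?x ^ k * contour_integral \<gamma> (\<lambda>z. f z * poly (q k) z / poly \<omega> z))
          + contour_integral \<gamma> ?E"
      proof -
        have iq: "(\<lambda>z. f z * poly (q k) z / poly \<omega> z) contour_integrable_on \<gamma>" for k
          by (rule contour_integrable_holomorphic_simple[OF hq U(1) \<gamma>(1) \<gamma>U])
        have iE: "?E contour_integrable_on \<gamma>"
          by (rule contour_integrable_holomorphic_simple[OF hE U(1) \<gamma>(1) \<gamma>U])
        have il: "(\<lambda>z. ?x ^ k * (f z * poly (q k) z / poly \<omega> z)) contour_integrable_on \<gamma>" for k
          by (rule contour_integrable_lmul[OF iq])
        show ?thesis
          unfolding contour_integral_add[OF contour_integrable_sum[OF finite_lessThan il] iE]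
            contour_integral_sum[OF finite_lessThan il] contour_integral_lmul[OF iq] by (rule refl)
      qed
      also have "(\<Sum>k<degree \<omega>. ?x ^ k * contour_integral \<gamma> (\<lambda>z. f z * poly (q k) z / poly \<omega> z))
          = 2 * pi * \<i> * poly p ?x"
        by (simp add: p_def poly_sum poly_monom sum_distrib_left c_def mult_ac)
      finally have "2 * pi * \<i> * (f ?x - poly p ?x) = contour_integral \<gamma> ?E"
        by (simp add: algebra_simps)
      then have "2 * pi * cmod (f ?x - poly p ?x) = cmod (contour_integral \<gamma> ?E)"
        by (simp add: norm_mult flip: \<open>2 * pi * \<i> * (f ?x - poly p ?x) = contour_integral \<gamma> ?E\<close>)
      also have "\<dots> \<le> L * (M / (s * \<delta>))"
      proof (rule L(2)[OF hE])
        fix z assume z: "z \<in> U"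
        have M0: "0 \<le> M" using M[of z] z U(2) order.trans[OF norm_ge_zero] by blast
        have "cmod (f z) * cmod (poly \<omega> ?x) \<le> M * 1"
          using M[of z] z U(2) chebyshev_inside[OF \<omega>(2) x]
          M0 by (intro mult_mono) auto
        moreover have "s * \<delta> \<le> cmod (poly \<omega> z) * cmod (z - ?x)"
          using \<omega>U[OF z] zx[OF z] s \<delta>(1) by (intro mult_mono) auto
        ultimately show "cmod (?E z) \<le> M / (s * \<delta>)"
          using s \<delta>(1) M0 unfolding norm_divide norm_mult by (intro frac_le) auto
      qed
      finally have "cmod (f ?x - poly p ?x) * (2 * pi) \<le> L * (M / (s * \<delta>))"
        by (simp only: mult_ac)
      then have "cmod (f ?x - poly p ?x) \<le> L * (M / (s * \<delta>)) / (2 * pi)"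
        by (subst pos_le_divide_eq) simp_all
      also have "\<dots> = K * M / R ^ n" using R \<delta>(1) by (simp add: s_def K_def field_simps)
      finally show ?thesis .
    qed
    ultimately show ?thesis by blast
  qed
  show ?thesis
    by (rule exI[of _ K], rule conjI[OF K], rule exI[of _ R], rule conjI[OF R],
        intro allI impI, rule main[unfolded S_def])
qed

section \<open>Interpolation in several variables\<close>

text \<open>The coefficients of the shifted polynomial are its Taylor coefficients at
  \<open>v\<close>, so each summand is a function of \<open>u\<close> times a function of
  \<open>v\<close>. This is where the factor \<open>n\<close> per variable in the rank
  originates.\<close>

lemma poly_add_expansion:
  fixes p :: "'a :: {comm_semiring_1, semiring_no_zero_divisors} poly"
  assumes "degree p < n"
  shows "poly p (u + v) = (\<Sum>k<n. u ^ k * coeff (pcompose p [:v, 1:]) k)"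
proof -
  let ?q = "pcompose p [:v, 1:]"
  have "degree ?q < n" using assms by (simp add: degree_pcompose)
  then have "(\<Sum>k<n. u ^ k * coeff ?q k) = (\<Sum>k\<le>degree ?q. coeff ?q k * u ^ k)"
    by (intro sum.mono_neutral_cong_right) (auto simp: coeff_eq_0 mult.commute)
  also have "\<dots> = poly p (u + v)"
    unfolding poly_altdef[symmetric] by (simp add: poly_pcompose add.commute)
  finally show ?thesis by simp
qed

section \<open>Lagrange interpolation at Fekete points\<close>

definition lagrange_basis :: "real set \<Rightarrow> real \<Rightarrow> complex poly" where
  "lagrange_basis S y =
     Polynomial.smult (complex_of_real (1 / (\<Prod>u\<in>S - {y}. y - u))) (\<Prod>u\<in>S - {y}. [:- complex_of_real u, 1:])"

lemma poly_lagrange_basis: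
  "poly (lagrange_basis S y) (complex_of_real x)
     = complex_of_real ((\<Prod>u\<in>S - {y}. x - u) / (\<Prod>u\<in>S - {y}. y - u))"
  by (simp add: lagrange_basis_def poly_prod)

lemma degree_lagrange_basis:
  assumes "finite S" "y \<in> S"
  shows "degree (lagrange_basis S y) < card S"
proof -
  have "degree (lagrange_basis S y) \<le> degree (\<Prod>u\<in>S - {y}. [:- complex_of_real u, 1:])"
    unfolding lagrange_basis_def by (rule degree_smult_le)
  also have "\<dots> \<le> (\<Sum>u\<in>S - {y}. degree [:- complex_of_real u, 1:])"
    by (rule degree_prod_sum_le[unfolded comp_def]) (use assms in simp)
  also have "\<dots> = card S - 1" using assms by simp
  also have "card S > 0" using assms by (auto simp: card_gt_0_iff)
  then have "card S - 1 < card S" by simp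
  finally show ?thesis .
qed

lemma poly_lagrange_basis_node:
  assumes "finite S" "y \<in> S" "x \<in> S"
  shows "poly (lagrange_basis S y) (complex_of_real x) = (if x = y then 1 else 0)"
proof (cases "x = y")
  case False
  then have "(\<Prod>u\<in>S - {y}. x - u) = 0" using assms by (intro prod_zero) auto
  then show ?thesis using False by (simp add: poly_lagrange_basis)
next
  case True
  have "(\<Prod>u\<in>S - {y}. y - u) \<noteq> 0" using assms by simp
  then show ?thesis using True by (simp add: poly_lagrange_basis)
qed

lemma lagrange_interpolation_exact:
  assumes "finite S" "degree p < card S"
  shows "poly p z = (\<Sum>y\<in>S. poly p (complex_of_real y) * poly (lagrange_basis S y) z)"
proof -
  let ?q = "\<Sum>y\<in>S. Polynomial.smult (poly p (complex_of_real y)) (lagrange_basis S y)"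
  have "p = ?q"
  proof (rule poly_eqI_degree[of "complex_of_real ` S"])
    fix z assume "z \<in> complex_of_real ` S"
    then obtain x where x: "x \<in> S" "z = complex_of_real x" by auto
    have "poly ?q z = (\<Sum>y\<in>S. if y = x then poly p (complex_of_real y) else 0)"
      unfolding poly_sum x(2)
      by (intro sum.cong refl) (use x assms in \<open>simp add: poly_lagrange_basis_node\<close>)
    then show "poly p z = poly ?q z" using x assms by simp
  next
    have card: "card (complex_of_real ` S) = card S" by (intro card_image inj_onI) simp
    show "degree p < card (complex_of_real ` S)" using assms card by simp
    show "degree ?q < card (complex_of_real ` S)" unfolding card
      by (rule degree_sum_less)
        (use assms degree_lagrange_basis degree_smult_le in \<open>fastforce intro: le_less_trans\<close>)+
  qed
  then have "poly p z = poly ?q z" by simp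
  then show ?thesis by (simp add: poly_sum)
qed

text \<open>The square of the absolute Vandermonde determinant: each unordered pair of nodes occurs
  twice. In this form it is a function of the node set and requires no enumeration of the
  nodes.\<close>

definition vandermonde_square :: "real set \<Rightarrow> real" where
  "vandermonde_square S = (\<Prod>p\<in>S. \<Prod>q\<in>S - {p}. \<bar>p - q\<bar>)"

lemma vandermonde_square_pos: "finite S \<Longrightarrow> vandermonde_square S > 0"
  unfolding vandermonde_square_def by (intro prod_pos) auto

lemma vandermonde_square_insert:
  assumes "finite T" "a \<notin> T"
  shows "vandermonde_square (insert a T) = (\<Prod>p\<in>T. \<bar>a - p\<bar>)\<^sup>2 * vandermonde_square T"
proof -
  have "vandermonde_square (insert a T)
      = (\<Prod>q\<in>T. \<bar>a - q\<bar>) * (\<Prod>p\<in>T. \<Prod>q\<in>insert a T - {p}. \<bar>p - q\<bar>)"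
    using assms by (simp add: vandermonde_square_def)
  also have "(\<Prod>p\<in>T. \<Prod>q\<in>insert a T - {p}. \<bar>p - q\<bar>) = (\<Prod>p\<in>T. \<bar>a - p\<bar> * (\<Prod>q\<in>T - {p}. \<bar>p - q\<bar>))"
  proof (rule prod.cong[OF refl])
    fix p assume "p \<in> T"
    then have "insert a T - {p} = insert a (T - {p})" using assms by auto
    then show "(\<Prod>q\<in>insert a T - {p}. \<bar>p - q\<bar>) = \<bar>a - p\<bar> * (\<Prod>q\<in>T - {p}. \<bar>p - q\<bar>)"
      using assms by (simp add: abs_minus_commute)
  qed
  finally show ?thesis
    by (simp add: prod.distrib vandermonde_square_def power2_eq_square)
qed

text \<open>Fekete points: maximality of the Vandermonde determinant bounds every Lagrange basis
  polynomial by one.\<close>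

lemma fekete_nodes:
  fixes X :: "real set"
  assumes X: "finite X" and D: "D \<le> card X"
  obtains S where "S \<subseteq> X" "card S = D"
    "\<And>y x. y \<in> S \<Longrightarrow> x \<in> X \<Longrightarrow> cmod (poly (lagrange_basis S y) (complex_of_real x)) \<le> 1"
proof -
  define F where "F = {S. S \<subseteq> X \<and> card S = D}"
  have F: "finite F" "F \<noteq> {}"
    using X obtain_subset_with_card_n[OF D] by (auto simp: F_def)
  obtain S where S: "S \<in> F" "\<And>S'. S' \<in> F \<Longrightarrow> vandermonde_square S' \<le> vandermonde_square S"
    using obtains_MAX[OF F, of vandermonde_square] by (metis F(1) Max_ge finite_imageI imageI)
  have fS: "finite S" using S(1) X by (auto simp: F_def intro: finite_subset)
  have "cmod (poly (lagrange_basis S y) (complex_of_real x)) \<le> 1" if y: "y \<in> S" and x: "x \<in> X" for x y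
  proof (cases "x \<in> S")
    case True
    then show ?thesis using fS y by (simp add: poly_lagrange_basis_node)
  next
    case False
    define T where "T = S - {y}"
    have T: "finite T" "y \<notin> T" "x \<notin> T" "insert y T = S" using fS y False by (auto simp: T_def)
    have "card (insert x T) = card S" using T by (metis card_insert_disjoint)
    then have "insert x T \<in> F" using S(1) x by (auto simp: F_def T_def)
    \<comment> \<open>Exchanging the node \<open>y\<close> for \<open>x\<close> cannot increase the
      maximal value. After cancelling the common factor of \<open>T\<close>, what remains is
      precisely the bound for the Lagrange basis polynomial of \<open>y\<close> at
      \<open>x\<close>.\<close>
    then have "vandermonde_square (insert x T) \<le> vandermonde_square (insert y T)"
      unfolding T(4) by (rule S(2))
    then have "(\<Prod>p\<in>T. \<bar>x - p\<bar>)\<^sup>2 \<le> (\<Prod>p\<in>T. \<bar>y - p\<bar>)\<^sup>2"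
      using T(1-3) vandermonde_square_pos[OF T(1)] by (simp add: vandermonde_square_insert)
    then have "(\<Prod>p\<in>T. \<bar>x - p\<bar>) \<le> (\<Prod>p\<in>T. \<bar>y - p\<bar>)"
      by (rule power2_le_imp_le) (simp add: prod_nonneg)
    moreover have "(\<Prod>p\<in>T. \<bar>y - p\<bar>) > 0" using T by (intro prod_pos) auto
    ultimately show ?thesis
      unfolding poly_lagrange_basis norm_of_real by (simp add: T_def abs_prod)
  qed
  with S(1) show ?thesis using that by (auto simp: F_def)
qed

text \<open>The last clause is Lebesgue's inequality: interpolation is at most a factor
  \<open>1 + D\<close> worse than any polynomial of degree below \<open>D\<close>. The condition
  \<open>card S \<le> D\<close> leaves room for sets \<open>X\<close> with fewer than
  \<open>D\<close> points.\<close>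

definition stable_nodes :: "real set \<Rightarrow> nat \<Rightarrow> real set \<Rightarrow> bool" where
  "stable_nodes X D S \<longleftrightarrow> S \<subseteq> X \<and> card S \<le> D \<and>
     (\<forall>y\<in>S. degree (lagrange_basis S y) < D) \<and>
     (\<forall>y\<in>S. \<forall>x\<in>X. cmod (poly (lagrange_basis S y) (complex_of_real x)) \<le> 1) \<and>
     (\<forall>f p \<epsilon>. degree p < D \<longrightarrow>
        (\<forall>x\<in>X. cmod (f x - poly p (complex_of_real x)) \<le> \<epsilon>) \<longrightarrow>
        (\<forall>x\<in>X. cmod (f x - (\<Sum>y\<in>S. poly (lagrange_basis S y) (complex_of_real x) * f y))
           \<le> (1 + real D) * \<epsilon>))"

lemma stable_nodes_exist:
  fixes X :: "real set"
  assumes X: "finite X"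
  shows "\<exists>S. stable_nodes X D S"
proof -
  obtain S where S: "S \<subseteq> X" "card S = min D (card X)"
    "\<And>y x. y \<in> S \<Longrightarrow> x \<in> X \<Longrightarrow> cmod (poly (lagrange_basis S y) (complex_of_real x)) \<le> 1"
    using fekete_nodes[OF X, of "min D (card X)"] by auto
  have fS: "finite S" using S(1) X by (rule finite_subset)
  have deg: "degree (lagrange_basis S y) < D" if "y \<in> S" for y
    using degree_lagrange_basis[OF fS that] S(2) by simp
  have "cmod (f x - (\<Sum>y\<in>S. poly (lagrange_basis S y) (complex_of_real x) * f y)) \<le> (1 + real D) * \<epsilon>"
    if p: "degree p < D" and fp: "\<And>x. x \<in> X \<Longrightarrow> cmod (f x - poly p (complex_of_real x)) \<le> \<epsilon>"
      and x: "x \<in> X" for f p \<epsilon> x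
  proof (cases "D \<le> card X")
    case True
    then have "degree p < card S" using S(2) p by simp
    let ?l = "\<lambda>y. poly (lagrange_basis S y) (complex_of_real x)"
    \<comment> \<open>Interpolation reproduces \<open>p\<close>, so only \<open>f - p\<close> is
      interpolated, and each node contributes at most \<open>\<epsilon>\<close>.\<close>
    have "f x - (\<Sum>y\<in>S. ?l y * f y)
        = (f x - poly p (complex_of_real x)) - (\<Sum>y\<in>S. ?l y * (f y - poly p (complex_of_real y)))"
      unfolding lagrange_interpolation_exact[OF fS \<open>degree p < card S\<close>, of "complex_of_real x"]
      by (simp add: sum_subtractf algebra_simps)
    also have "cmod \<dots> \<le> \<epsilon> + (\<Sum>y\<in>S. 1 * \<epsilon>)"
    proof (rule order.trans[OF norm_triangle_ineq4], rule add_mono, rule fp[OF x], rule sum_norm_le)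
      fix y assume y: "y \<in> S"
      show "cmod (?l y * (f y - poly p (complex_of_real y))) \<le> 1 * \<epsilon>"
        unfolding norm_mult using S(1) y by (intro mult_mono S(3) fp x) auto
    qed
    also have "\<dots> = (1 + real (card S)) * \<epsilon>" by (simp add: algebra_simps)
    also have "\<dots> = (1 + real D) * \<epsilon>" using True S(2) by simp
    finally show ?thesis .
  next
    case False
    \<comment> \<open>With fewer than \<open>D\<close> points in \<open>X\<close>, all of them are
      nodes and \<open>f\<close> is reproduced on \<open>X\<close>; only the nonnegativity of
      \<open>\<epsilon>\<close> remains, which follows from \<open>fp\<close>.\<close>
    then have "S = X" using S X by (simp add: card_subset_eq)
    have "(\<Sum>y\<in>S. poly (lagrange_basis S y) (complex_of_real x) * f y) = (\<Sum>y\<in>S. if y = x then f y else 0)"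
      by (intro sum.cong refl) (use x fS \<open>S = X\<close> in \<open>simp add: poly_lagrange_basis_node\<close>)
    also have "\<dots> = f x" using x fS \<open>S = X\<close> by simp
    finally show ?thesis using order.trans[OF norm_ge_zero fp[OF x]] by simp
  qed
  then have "stable_nodes X D S"
    unfolding stable_nodes_def using S deg by auto
  then show ?thesis by blast
qed

section \<open>Interpolation in one variable after another\<close>

text \<open>The tensor product of the interpolation operators in the first \<open>m\<close>
  coordinates; the other coordinates are passed on to \<open>g\<close> unchanged.\<close>

primrec iterated_interpolation ::
  "(nat \<Rightarrow> real set) \<Rightarrow> nat \<Rightarrow> ((nat \<Rightarrow> real) \<Rightarrow> complex) \<Rightarrow> (nat \<Rightarrow> real) \<Rightarrow> complex" where
  "iterated_interpolation S 0 g = g"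
| "iterated_interpolation S (Suc m) g = (\<lambda>x.
     \<Sum>y\<in>S m. poly (lagrange_basis (S m) y) (complex_of_real (x m)) * iterated_interpolation S m g (x(m := y)))"

text \<open>Interpolating in coordinate \<open>m\<close> adds a fresh one-variable error
  \<open>\<eta>\<close> and applies an operator of norm at most \<open>D\<close> to the earlier
  error, so the error obeys E' <= \<eta> + D E. Since nodes are taken from \<open>X\<close>, all
  slices pass through points of the grid, where \<open>err\<close> applies.\<close>

lemma iterated_interpolation_error:
  assumes S: "\<And>i. i < \<mu> \<Longrightarrow> S i \<subseteq> X i" "\<And>i. i < \<mu> \<Longrightarrow> card (S i) \<le> D"
    and bound: "\<And>i y t. i < \<mu> \<Longrightarrow> y \<in> S i \<Longrightarrow> t \<in> X i \<Longrightarrow>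
       cmod (poly (lagrange_basis (S i) y) (complex_of_real t)) \<le> 1"
    and err: "\<And>i x. i < \<mu> \<Longrightarrow> x \<in> Pi\<^sub>E {..<\<mu>} X \<Longrightarrow>
       cmod (g x - (\<Sum>y\<in>S i. poly (lagrange_basis (S i) y) (complex_of_real (x i)) * g (x(i := y)))) \<le> \<eta>"
    and D: "D \<ge> 1" and \<eta>: "\<eta> \<ge> 0" and "m \<le> \<mu>" "x \<in> Pi\<^sub>E {..<\<mu>} X"
  shows "cmod (g x - iterated_interpolation S m g x) \<le> real m * real D ^ m * \<eta>"
  using \<open>m \<le> \<mu>\<close> \<open>x \<in> Pi\<^sub>E {..<\<mu>} X\<close>
proof (induction m arbitrary: x)
  case (Suc m)
  then have m: "m < \<mu>" by simp
  let ?l = "\<lambda>y. poly (lagrange_basis (S m) y) (complex_of_real (x m))"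
  have xm: "x m \<in> X m" using Suc.prems m by auto
  have "g x - iterated_interpolation S (Suc m) g x = (g x - (\<Sum>y\<in>S m. ?l y * g (x(m := y))))
      + (\<Sum>y\<in>S m. ?l y * (g (x(m := y)) - iterated_interpolation S m g (x(m := y))))"
    by (simp add: sum_subtractf algebra_simps)
  also have "cmod \<dots> \<le> \<eta> + (\<Sum>y\<in>S m. 1 * (real m * real D ^ m * \<eta>))"
  proof (intro order.trans[OF norm_triangle_ineq] add_mono err m sum_norm_le Suc.prems)
    fix y assume y: "y \<in> S m"
    then have "x(m := y) \<in> Pi\<^sub>E {..<\<mu>} X"
      using Suc.prems m S(1)[OF m] by (auto simp: PiE_iff extensional_def)
    then show "cmod (?l y * (g (x(m := y)) - iterated_interpolation S m g (x(m := y))))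
        \<le> 1 * (real m * real D ^ m * \<eta>)"
      unfolding norm_mult using Suc.IH m y xm by (intro mult_mono bound) auto
  qed
  also have "\<dots> = \<eta> + real (card (S m)) * (real m * real D ^ m * \<eta>)" by simp
  also have "\<dots> \<le> real D ^ Suc m * \<eta> + real D * (real m * real D ^ m * \<eta>)"
    using S(2)[OF m] D \<eta> mult_right_mono[OF one_le_power[of "real D" "Suc m"] \<eta>]
    by (intro add_mono mult_right_mono) auto
  also have "\<dots> = real (Suc m) * real D ^ Suc m * \<eta>" by (simp add: algebra_simps)
  finally show ?case .
qed simp

lemma sum_lessThan_mult:
  fixes f :: "nat \<Rightarrow> nat \<Rightarrow> 'a :: comm_monoid_add"
  shows "(\<Sum>i<a. \<Sum>j<b. f i j) = (\<Sum>k<a * b. f (k mod a) (k div a))"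
proof (cases "a = 0")
  case False
  have "(\<Sum>i<a. \<Sum>j<b. f i j) = (\<Sum>(i, j)\<in>{..<a} \<times> {..<b}. f i j)"
    by (rule sum.cartesian_product)
  also have "\<dots> = (\<Sum>k<a * b. f (k mod a) (k div a))"
  proof (rule sum.reindex_bij_witness[of _ "\<lambda>k. (k mod a, k div a)" "\<lambda>(i, j). i + a * j"])
    fix p assume p: "p \<in> {..<a} \<times> {..<b}"
    then obtain i j where ij: "p = (i, j)" "i < a" "j < b" by auto
    have "i + a * j < a * Suc j" using ij by simp
    also have "\<dots> \<le> a * b" using ij by (intro mult_left_mono) auto
    finally show "(case p of (i, j) \<Rightarrow> i + a * j) \<in> {..<a * b}" using ij by simp
  next
    fix k assume "k \<in> {..<a * b}"
    then show "(k mod a, k div a) \<in> {..<a} \<times> {..<b}"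
      using False by (auto simp: less_mult_imp_div_less mult.commute)
  qed (use False in auto)
  finally show ?thesis .
qed simp

text \<open>Binomial expansion of the powers of \<open>u i + v i\<close> separates the two arguments.\<close>

lemma iterated_interpolation_low_rank:
  assumes "\<And>i y. i < m \<Longrightarrow> y \<in> S i \<Longrightarrow> degree (lagrange_basis (S i) y) < D"
  shows "\<exists>\<alpha> \<beta>. \<forall>u v w. iterated_interpolation S m g (\<lambda>i. if i < m then u i + v i else w i)
     = (\<Sum>k<D ^ m. \<alpha> k u * \<beta> k v w)"
  using assms
proof (induction m)
  case 0
  show ?case by (intro exI[of _ "\<lambda>_ _. 1"] exI[of _ "\<lambda>_ _. g"]) simp
next
  case (Suc m)
  then obtain \<alpha> \<beta> where IH:
    "\<And>u v w. iterated_interpolation S m g (\<lambda>i. if i < m then u i + v i else w i)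
     = (\<Sum>k<D ^ m. \<alpha> k u * \<beta> k v w)" by auto
  define c where "c y k v = coeff (pcompose (lagrange_basis (S m) y) [:complex_of_real (v m), 1:]) k"
    for y k and v :: "nat \<Rightarrow> real"
  \<comment> \<open>A single index encodes a pair: \<open>k mod D\<close> is the power of
    \<open>u m\<close>, and \<open>k div D\<close> is the index inherited from the earlier
    coordinates.\<close>
  define \<alpha>' where "\<alpha>' k u = complex_of_real (u m) ^ (k mod D) * \<alpha> (k div D) u" for k u
  define \<beta>' where "\<beta>' k v w = (\<Sum>y\<in>S m. c y (k mod D) v * \<beta> (k div D) v (w(m := y)))" for k v w
  have "iterated_interpolation S (Suc m) g (\<lambda>i. if i < Suc m then u i + v i else w i)
      = (\<Sum>k<D ^ Suc m. \<alpha>' k u * \<beta>' k v w)" for u v w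
  proof -
    \<comment> \<open>In the inner interpolation, coordinate \<open>m\<close> holds the node
      \<open>y\<close> and is no longer a sum of \<open>u\<close> and \<open>v\<close> parts. The
      parameter \<open>w\<close> of the induction exists to carry such values.\<close>
    have upd: "(\<lambda>i. if i < Suc m then u i + v i else w i)(m := y)
        = (\<lambda>i. if i < m then u i + v i else (w(m := y)) i)" for y by auto
    have "iterated_interpolation S (Suc m) g (\<lambda>i. if i < Suc m then u i + v i else w i)
      = (\<Sum>y\<in>S m. poly (lagrange_basis (S m) y) (complex_of_real (u m) + complex_of_real (v m)) *
          (\<Sum>k<D ^ m. \<alpha> k u * \<beta> k v (w(m := y))))"
      by (simp add: upd IH del: fun_upd_apply)
    also have "\<dots> = (\<Sum>y\<in>S m. (\<Sum>i<D. complex_of_real (u m) ^ i * c y i v) *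
          (\<Sum>k<D ^ m. \<alpha> k u * \<beta> k v (w(m := y))))"
      unfolding c_def by (intro sum.cong refl) (simp add: poly_add_expansion[OF Suc.prems])
    also have "\<dots> = (\<Sum>y\<in>S m. \<Sum>i<D. \<Sum>k<D ^ m.
        (complex_of_real (u m) ^ i * \<alpha> k u) * (c y i v * \<beta> k v (w(m := y))))"
      by (simp add: sum_product mult_ac)
    also have "\<dots> = (\<Sum>i<D. \<Sum>k<D ^ m. \<Sum>y\<in>S m.
        (complex_of_real (u m) ^ i * \<alpha> k u) * (c y i v * \<beta> k v (w(m := y))))"
      by (subst sum.swap, intro sum.cong refl, rule sum.swap)
    also have "\<dots> = (\<Sum>k<D ^ Suc m. \<alpha>' k u * \<beta>' k v w)"
      unfolding sum_lessThan_mult by (simp add: \<alpha>'_def \<beta>'_def sum_distrib_left)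
    finally show ?thesis .
  qed
  then show ?case by blast
qed

section \<open>Low-rank approximation of analytic functions\<close>

text \<open>When only coordinate \<open>i\<close> moves, the differences \<open>z j - p j\<close>
  vanish for all other \<open>j\<close>. So only the multi-indices \<open>e k\<close> concentrated
  at \<open>i\<close> survive, and the series restricts to a power series in one variable.\<close>

lemma analytic_several_slice_holomorphic:
  assumes h: "analytic_several m h (Pi\<^sub>E {..<m} B)" and i: "i < m" and x: "x \<in> Pi\<^sub>E {..<m} B"
  shows "(\<lambda>z. h (x(i := z))) holomorphic_on B i"
  unfolding holomorphic_on_def
proof
  fix z0 assume z0: "z0 \<in> B i"
  let ?p = "x(i := z0)"
  let ?E = "Pi\<^sub>E {..<m} (\<lambda>_. UNIV :: nat set)"
  have p: "?p \<in> Pi\<^sub>E {..<m} B" using x i z0 by (auto simp: PiE_iff extensional_def)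
  then obtain r \<alpha> where r: "r > 0" and \<alpha>: "\<And>z. z \<in> (\<Pi>\<^sub>E j\<in>{..<m}. ball (?p j) r) \<Longrightarrow>
      ((\<lambda>e. \<alpha> e * (\<Prod>j<m. (z j - ?p j) ^ e j)) has_sum h z) ?E"
    using bspec[OF h[unfolded analytic_several_def] p] by blast
  define e where "e k = (\<lambda>j\<in>{..<m}. if j = i then k else (0::nat))" for k
  have e_i: "e k i = k" for k using i by (simp add: e_def)
  then have inj: "inj e" by (metis injI)
  have "(\<lambda>z. h (x(i := z))) holomorphic_on ball z0 r"
  proof (rule power_series_holomorphic)
    fix z assume z: "z \<in> ball z0 r"
    have "x(i := z) \<in> (\<Pi>\<^sub>E j\<in>{..<m}. ball (?p j) r)"
      using x i z r by (auto simp: PiE_iff extensional_def)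
    note hs = \<alpha>[OF this]
    have prod: "(\<Prod>j<m. ((x(i := z)) j - ?p j) ^ f j)
        = (if f \<in> range e then (z - z0) ^ f i else 0)" if f: "f \<in> ?E" for f
    proof (cases "\<exists>j<m. j \<noteq> i \<and> f j \<noteq> 0")
      case True
      then obtain j where j: "j < m" "j \<noteq> i" "f j \<noteq> 0" by blast
      then have "f \<notin> range e" by (auto simp: e_def)
      moreover have "(\<Prod>j<m. ((x(i := z)) j - ?p j) ^ f j) = 0"
        using j by (intro prod_zero) auto
      ultimately show ?thesis by simp
    next
      case False
      have "f = e (f i)" using False f i by (auto simp: e_def fun_eq_iff PiE_iff extensional_def)
      moreover have "(\<Prod>j<m. ((x(i := z)) j - ?p j) ^ f j) = (\<Prod>j\<in>{i}. ((x(i := z)) j - ?p j) ^ f j)"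
        using False i by (intro prod.mono_neutral_right) auto
      ultimately show ?thesis by auto
    qed
    have range: "range e \<subseteq> ?E" by (rule image_subsetI) (simp add: e_def restrict_PiE_iff)
    have "((\<lambda>f. \<alpha> f * (z - z0) ^ f i) has_sum h (x(i := z))) (range e)"
      by (rule has_sum_cong_neutral[THEN iffD1, OF _ _ _ hs])
        (use range prod in \<open>auto simp del: fun_upd_apply\<close>)
    then have "((\<lambda>k. \<alpha> (e k) * (z - z0) ^ k) has_sum h (x(i := z))) UNIV"
      using inj by (simp add: has_sum_reindex comp_def e_i)
    then show "(\<lambda>k. \<alpha> (e k) * (z - z0) ^ k) sums h (x(i := z))" by (rule has_sum_imp_sums)
  qed
  then show "(\<lambda>z. h (x(i := z))) field_differentiable at z0 within B i"
    using r by (meson centre_in_ball field_differentiable_at_within holomorphic_on_imp_differentiable_at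
        open_ball)
qed

text \<open>\<open>K\<close> and \<open>R\<close> belong to the smallest admissible ellipse, which
  every slice can be restricted to, and thus depend on \<open>a_min\<close> alone. The factors are
  chosen before \<open>u\<close> and \<open>v\<close>, so the sum is a matrix of rank at most
  \<open>D ^ \<mu>\<close> in these two arguments.\<close>

lemma analytic_low_rank_approximation:
  assumes a: "a_min > 0"
  shows "\<exists>K>0. \<exists>R>1. \<forall>C \<mu> g X D. bounded_bernstein_extension C a_min \<mu> g \<longrightarrow> D \<ge> 1 \<longrightarrow> C \<ge> 0 \<longrightarrow>
      (\<forall>i<\<mu>. finite (X i) \<and> X i \<subseteq> {-1..1}) \<longrightarrow>
      (\<exists>\<alpha> \<beta>. \<forall>u v. (\<lambda>i\<in>{..<\<mu>}. u i + v i) \<in> Pi\<^sub>E {..<\<mu>} X \<longrightarrow>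
        cmod (g (\<lambda>i\<in>{..<\<mu>}. u i + v i) - (\<Sum>k<D ^ \<mu>. \<alpha> k u * \<beta> k v))
          \<le> real \<mu> * real D ^ \<mu> * ((1 + real D) * (K * C / R ^ D)))"
proof -
  obtain K R where KR: "K > 0" "R > 1"
    and approx: "\<forall>f M n. n \<ge> 1 \<longrightarrow> f holomorphic_on bernstein_ellipse a_min \<longrightarrow>
       (\<forall>z\<in>bernstein_ellipse a_min. cmod (f z) \<le> M) \<longrightarrow>
       (\<exists>p. degree p < n \<and>
         (\<forall>x\<in>{-1..1}. cmod (f (complex_of_real x) - poly p (complex_of_real x)) \<le> K * M / R ^ n))"
    using bernstein_polynomial_approximation[OF a] by (elim exE conjE)
  have main: "\<exists>\<alpha> \<beta>. \<forall>u v. (\<lambda>i\<in>{..<\<mu>}. u i + v i) \<in> Pi\<^sub>E {..<\<mu>} X \<longrightarrow>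
        cmod (g (\<lambda>i\<in>{..<\<mu>}. u i + v i) - (\<Sum>k<D ^ \<mu>. \<alpha> k u * \<beta> k v))
          \<le> real \<mu> * real D ^ \<mu> * ((1 + real D) * (K * C / R ^ D))"
    if ext: "bounded_bernstein_extension C a_min \<mu> g" and D: "D \<ge> 1" and C: "C \<ge> 0"
      and X_all: "\<forall>i<\<mu>. finite (X i) \<and> X i \<subseteq> {-1..1}" for C \<mu> g X D
  proof -
    have X: "finite (X i)" "X i \<subseteq> {-1..1}" if "i < \<mu>" for i using X_all that by auto
    obtain a' h where a': "\<forall>i<\<mu>. a' i \<ge> a_min"
      and h: "analytic_several \<mu> h (\<Pi>\<^sub>E i\<in>{..<\<mu>}. bernstein_ellipse (a' i))"
      and hg: "\<forall>x\<in>(\<Pi>\<^sub>E i\<in>{..<\<mu>}. {-1..1}). h (\<lambda>i\<in>{..<\<mu>}. complex_of_real (x i)) = g x"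
      and hC: "\<forall>z\<in>(\<Pi>\<^sub>E i\<in>{..<\<mu>}. bernstein_ellipse (a' i)). cmod (h z) \<le> C"
      using ext unfolding bounded_bernstein_extension_def by (elim exE conjE)
    have "\<exists>S. stable_nodes (X i) D S" if "i < \<mu>" for i
      by (rule stable_nodes_exist[OF X(1)[OF that]])
    then have "\<forall>i. \<exists>S. i < \<mu> \<longrightarrow> stable_nodes (X i) D S" by simp
    from choice[OF this] obtain S where S: "\<And>i. i < \<mu> \<Longrightarrow> stable_nodes (X i) D (S i)" by auto
    let ?\<eta> = "(1 + real D) * (K * C / R ^ D)"
    have err: "cmod (g x - (\<Sum>y\<in>S i. poly (lagrange_basis (S i) y) (complex_of_real (x i)) * g (x(i := y)))) \<le> ?\<eta>"
      if i: "i < \<mu>" and x: "x \<in> Pi\<^sub>E {..<\<mu>} X" for i x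
    proof -
      let ?xc = "\<lambda>j\<in>{..<\<mu>}. complex_of_real (x j)"
      let ?f = "\<lambda>z. h (?xc(i := z))"
      have x1: "x j \<in> {-1..1}" if "j < \<mu>" for j using PiE_mem[OF x, of j] X(2)[OF that] that by auto
      have xc: "?xc \<in> (\<Pi>\<^sub>E j\<in>{..<\<mu>}. bernstein_ellipse (a' j))"
      proof -
        have "complex_of_real (x j) \<in> bernstein_ellipse (a' j)" if "j < \<mu>" for j
          by (rule real_interval_subset_bernstein_ellipse[OF less_le_trans[OF a a'[rule_format, OF that]] x1[OF that]])
        then show ?thesis by auto
      qed
      have sub: "bernstein_ellipse a_min \<subseteq> bernstein_ellipse (a' i)"
        using bernstein_ellipse_mono[OF a a'[rule_format, OF i]] .
      have hol: "?f holomorphic_on bernstein_ellipse a_min"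
        using analytic_several_slice_holomorphic[OF h i xc] sub by (rule holomorphic_on_subset)
      have bd: "cmod (?f z) \<le> C" if "z \<in> bernstein_ellipse a_min" for z
        by (rule hC[rule_format]) (use xc that sub i in \<open>auto simp: PiE_iff extensional_def\<close>)
      have "\<exists>p. degree p < D \<and> (\<forall>t\<in>{-1..1}.
          cmod (?f (complex_of_real t) - poly p (complex_of_real t)) \<le> K * C / R ^ D)"
        by (rule approx[rule_format, OF D hol]) (rule bd)
      then obtain p where p: "degree p < D" "\<forall>t\<in>{-1..1}.
          cmod (?f (complex_of_real t) - poly p (complex_of_real t)) \<le> K * C / R ^ D"
        by (elim exE conjE)
      have fg: "?f (complex_of_real t) = g (x(i := t))" if t: "t \<in> {-1..1}" for t
      proof -
        have "?xc(i := complex_of_real t) = (\<lambda>j\<in>{..<\<mu>}. complex_of_real ((x(i := t)) j))"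
          using i by auto
        moreover have "x(i := t) \<in> (\<Pi>\<^sub>E j\<in>{..<\<mu>}. {-1..1})"
          using x x1 i t by (auto simp: PiE_iff extensional_def)
        ultimately show ?thesis by (simp only: hg[rule_format])
      qed
      have near: "\<forall>t\<in>X i. cmod (g (x(i := t)) - poly p (complex_of_real t)) \<le> K * C / R ^ D"
      proof
        fix t assume "t \<in> X i"
        then have t: "t \<in> {-1..1}" using X(2)[OF i] by auto
        show "cmod (g (x(i := t)) - poly p (complex_of_real t)) \<le> K * C / R ^ D"
          using bspec[OF p(2) t] unfolding fg[OF t] .
      qed
      have stable: "cmod (f t - (\<Sum>y\<in>S i. poly (lagrange_basis (S i) y) (complex_of_real t) * f y))
          \<le> (1 + real D) * \<epsilon>"
        if "degree p < D" "\<forall>t\<in>X i. cmod (f t - poly p (complex_of_real t)) \<le> \<epsilon>" "t \<in> X i" for f p \<epsilon> t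
        using S[OF i] that unfolding stable_nodes_def by blast
      have "x i \<in> X i" using x i by auto
      from stable[of p "\<lambda>t. g (x(i := t))", OF p(1) near this] show ?thesis by simp
    qed
    have \<eta>: "?\<eta> \<ge> 0" using KR C by auto
    have deg: "degree (lagrange_basis (S i) y) < D" if "i < \<mu>" "y \<in> S i" for i y
      using S[OF that(1)] that(2) unfolding stable_nodes_def by blast
    have "\<exists>\<alpha> \<beta>. \<forall>u v w. iterated_interpolation S \<mu> g (\<lambda>i. if i < \<mu> then u i + v i else w i)
        = (\<Sum>k<D ^ \<mu>. \<alpha> k u * \<beta> k v w)"
      by (rule iterated_interpolation_low_rank) (rule deg)
    then obtain \<alpha> \<beta> where \<alpha>\<beta>: "\<forall>u v w. iterated_interpolation S \<mu> g (\<lambda>i. if i < \<mu> then u i + v i else w i)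
        = (\<Sum>k<D ^ \<mu>. \<alpha> k u * \<beta> k v w)"
      by (elim exE)
    \<comment> \<open>Points are extensional, so the values \<open>w\<close> beyond the first
      \<open>\<mu>\<close> coordinates have to be \<open>undefined\<close>.\<close>
    have final: "cmod (g (\<lambda>i\<in>{..<\<mu>}. u i + v i) - (\<Sum>k<D ^ \<mu>. \<alpha> k u * \<beta> k v (\<lambda>_. undefined)))
          \<le> real \<mu> * real D ^ \<mu> * ?\<eta>" if uv: "(\<lambda>i\<in>{..<\<mu>}. u i + v i) \<in> Pi\<^sub>E {..<\<mu>} X" for u v
    proof -
      have eq: "(\<lambda>i\<in>{..<\<mu>}. u i + v i) = (\<lambda>i. if i < \<mu> then u i + v i else undefined)" by auto
      have "cmod (g (\<lambda>i\<in>{..<\<mu>}. u i + v i) - iterated_interpolation S \<mu> g (\<lambda>i\<in>{..<\<mu>}. u i + v i))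
          \<le> real \<mu> * real D ^ \<mu> * ?\<eta>"
        by (rule iterated_interpolation_error[where X = X, OF _ _ _ err D \<eta> order.refl uv]) (use S in \<open>unfold stable_nodes_def, blast\<close>)+
      then show ?thesis unfolding eq \<alpha>\<beta>[rule_format] .
    qed
    show ?thesis
      by (rule exI[of _ \<alpha>], rule exI[of _ "\<lambda>k v. \<beta> k v (\<lambda>_. undefined)"], intro allI impI, rule final)
  qed
  show ?thesis
    by (rule exI[of _ K], rule conjI[OF KR(1)], rule exI[of _ R], rule conjI[OF KR(2)],
        intro allI impI, rule main)
qed

section \<open>Entanglement entropy\<close>

lemma finite_spins: "finite I \<Longrightarrow> finite (spins I)"
  by (simp add: spins_def finite_PiE)

lemma card_spins: "finite I \<Longrightarrow> card (spins I) = 2 ^ card I"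
  by (simp add: spins_def card_PiE numeral_2_eq_2)

lemma sum_spins_split:
  assumes "A \<subseteq> {..<n}"
  shows "(\<Sum>s\<in>spins {..<n}. f s) = (\<Sum>\<sigma>\<in>spins A. \<Sum>\<tau>\<in>spins ({..<n} - A). f (override_on \<tau> \<sigma> A))"
proof -
  have "(\<Sum>(\<sigma>, \<tau>)\<in>spins A \<times> spins ({..<n} - A). f (override_on \<tau> \<sigma> A)) = (\<Sum>s\<in>spins {..<n}. f s)"
  proof (rule sum.reindex_bij_witness[of _ "\<lambda>s. (restrict s A, restrict s ({..<n} - A))"
        "\<lambda>(\<sigma>, \<tau>). override_on \<tau> \<sigma> A"])
    fix p assume "p \<in> spins A \<times> spins ({..<n} - A)"
    then obtain \<sigma> \<tau> where p: "p = (\<sigma>, \<tau>)" "\<sigma> \<in> spins A" "\<tau> \<in> spins ({..<n} - A)" by auto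
    then show "(restrict (case p of (\<sigma>, \<tau>) \<Rightarrow> override_on \<tau> \<sigma> A) A,
        restrict (case p of (\<sigma>, \<tau>) \<Rightarrow> override_on \<tau> \<sigma> A) ({..<n} - A)) = p"
      by (auto simp: spins_def PiE_iff extensional_def override_on_def fun_eq_iff restrict_def)
    show "(case p of (\<sigma>, \<tau>) \<Rightarrow> override_on \<tau> \<sigma> A) \<in> spins {..<n}"
      using p assms by (auto simp: spins_def PiE_iff extensional_def override_on_def)
  next
    fix s assume s: "s \<in> spins {..<n}"
    then show "(case (restrict s A, restrict s ({..<n} - A)) of (\<sigma>, \<tau>) \<Rightarrow> override_on \<tau> \<sigma> A) = s"
      using assms by (auto simp: spins_def PiE_iff extensional_def override_on_def fun_eq_iff restrict_def)
    show "(restrict s A, restrict s ({..<n} - A)) \<in> spins A \<times> spins ({..<n} - A)"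
      using s assms by (auto simp: spins_def PiE_iff)
  qed auto
  then show ?thesis by (simp add: sum.cartesian_product)
qed

text \<open>With rows labelled by \<open>A\<close> and columns by the complement, the matrix of
  amplitudes has 2^n entries, so an entrywise error of 4^(-n) gives a squared error of at most
  8^(-n), below the square of \<epsilon> = 2^(-n). For this \<epsilon> the small eigenvalues
  contribute at most 2; with the 1 from the large ones this makes the constant 3.\<close>

lemma entanglement_entropy_low_rank:
  assumes norm: "normalized_state n \<Psi>" and A: "A \<subseteq> {..<n}" and r: "r \<ge> 1"
    and \<delta>: "0 \<le> \<delta>" "\<delta> \<le> 1 / 4 ^ n"
    and approx: "\<And>\<sigma> \<tau>. \<sigma> \<in> spins A \<Longrightarrow> \<tau> \<in> spins ({..<n} - A) \<Longrightarrow>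
      cmod (\<Psi> (override_on \<tau> \<sigma> A) - (\<Sum>k<r. \<alpha> k \<sigma> * \<beta> k \<tau>)) \<le> \<delta>"
  shows "entanglement_entropy n \<Psi> A \<le> ln (real r) + 3"
proof -
  define N where "N = card (spins A)"
  define T where "T = spins ({..<n} - A)"
  define \<iota> where "\<iota> = from_nat_into (spins A)"
  have fA: "finite A" using A finite_subset by blast
  have bij: "bij_betw \<iota> {..<N} (spins A)"
    unfolding \<iota>_def N_def using bij_betw_from_nat_into_finite finite_spins[OF fA] by blast
  then have \<iota>: "\<iota> i \<in> spins A" if "i < N" for i using that by (auto simp: bij_betw_def)
  have N: "N = 2 ^ card A" unfolding N_def by (rule card_spins[OF fA])
  have T: "finite T" "card T = 2 ^ (n - card A)"
    unfolding T_def using A fA by (auto simp: finite_spins card_spins card_Diff_subset)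
  have cA: "card A \<le> n" using card_mono[OF _ A] by simp
  have NT: "real N * real (card T) = 2 ^ n" using cA by (simp add: N T flip: power_add)
  have "von_neumann_entropy (reduced_density n \<Psi> A) \<le> ln (real r) + 1 + 2 * real N * (1 / 2 ^ n)"
  proof (rule entropy_low_rank[OF _ T(1) _ r])
    show "reduced_density n \<Psi> A
        = Matrix.mat N N (\<lambda>(i, j). \<Sum>\<tau>\<in>T. \<Psi> (override_on \<tau> (\<iota> i) A) * cnj (\<Psi> (override_on \<tau> (\<iota> j) A)))"
      by (simp add: reduced_density_def matrix_of_operator_def partial_trace_def projector_def
          N_def T_def \<iota>_def)
    have "(\<Sum>i<N. \<Sum>\<tau>\<in>T. (cmod (\<Psi> (override_on \<tau> (\<iota> i) A)))\<^sup>2)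
        = (\<Sum>\<sigma>\<in>spins A. \<Sum>\<tau>\<in>T. (cmod (\<Psi> (override_on \<tau> \<sigma> A)))\<^sup>2)"
      by (rule sum.reindex_bij_betw[OF bij])
    then show "(\<Sum>i<N. \<Sum>\<tau>\<in>T. (cmod (\<Psi> (override_on \<tau> (\<iota> i) A)))\<^sup>2) = 1"
      using norm sum_spins_split[OF A, of "\<lambda>s. (cmod (\<Psi> s))\<^sup>2"]
      by (simp add: normalized_state_def T_def)
    have "\<delta>\<^sup>2 \<le> (1 / 4 ^ n)\<^sup>2" using \<delta> by (intro power_mono) auto
    then have "2 ^ n * \<delta>\<^sup>2 \<le> 2 ^ n * (1 / 4 ^ n)\<^sup>2" by simp
    also have "\<dots> = (1 / 8) ^ n"
      by (simp add: power2_eq_square power_divide flip: power_mult_distrib)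
        (simp add: field_simps flip: power_mult_distrib)
    also have "\<dots> \<le> (1 / 4) ^ n" by (intro power_mono) auto
    also have "\<dots> = (1 / 2 ^ n)\<^sup>2" by (simp add: power2_eq_square power_divide flip: power_mult_distrib)
    finally show "real N * real (card T) * \<delta>\<^sup>2 \<le> (1 / 2 ^ n)\<^sup>2" unfolding NT .
    show "cmod (\<Psi> (override_on \<tau> (\<iota> i) A) - (\<Sum>k<r. \<alpha> k (\<iota> i) * \<beta> k \<tau>)) \<le> \<delta>"
      if "i < N" "\<tau> \<in> T" for i \<tau>
      using approx[OF \<iota>[OF that(1)]] that(2) by (simp add: T_def)
  qed simp
  moreover have "2 * real N * (1 / 2 ^ n) \<le> 2"
  proof -
    have "(2::real) ^ card A \<le> 2 ^ n" by (rule power_increasing[OF cA]) simp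
    then show ?thesis by (simp add: N divide_le_eq)
  qed
  ultimately show ?thesis by (simp add: entanglement_entropy_def)
qed

text \<open>Any amplitude matrix factors exactly through its row space, with indicator functions of
  the rows as left factors; the low-rank estimate then applies with error 0.\<close>

lemma entanglement_entropy_trivial_bound:
  assumes norm: "normalized_state n \<Psi>" and A: "A \<subseteq> {..<n}"
  shows "entanglement_entropy n \<Psi> A \<le> real n * ln 2 + 3"
proof -
  define N where "N = card (spins A)"
  define \<iota> where "\<iota> = from_nat_into (spins A)"
  have fA: "finite A" using A finite_subset by blast
  have bij: "bij_betw \<iota> {..<N} (spins A)"
    unfolding \<iota>_def N_def using bij_betw_from_nat_into_finite finite_spins[OF fA] by blast
  have N: "N = 2 ^ card A" unfolding N_def by (rule card_spins[OF fA])
  have cA: "card A \<le> n" using card_mono[OF _ A] by simp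
  have "entanglement_entropy n \<Psi> A \<le> ln (real N) + 3"
  proof (rule entanglement_entropy_low_rank[OF norm A, where \<delta> = 0])
    fix \<sigma> \<tau> assume \<sigma>: "\<sigma> \<in> spins A"
    have "(\<Sum>k<N. of_bool (\<sigma> = \<iota> k) * \<Psi> (override_on \<tau> (\<iota> k) A))
        = (\<Sum>\<sigma>'\<in>spins A. of_bool (\<sigma> = \<sigma>') * \<Psi> (override_on \<tau> \<sigma>' A))"
      by (rule sum.reindex_bij_betw[OF bij])
    also have "\<dots> = (\<Sum>\<sigma>'\<in>spins A. if \<sigma> = \<sigma>' then \<Psi> (override_on \<tau> \<sigma>' A) else 0)"
      by (intro sum.cong) auto
    also have "\<dots> = \<Psi> (override_on \<tau> \<sigma> A)" using \<sigma> finite_spins[OF fA] by simp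
    finally show "cmod (\<Psi> (override_on \<tau> \<sigma> A) -
        (\<Sum>k<N. of_bool (\<sigma> = \<iota> k) * \<Psi> (override_on \<tau> (\<iota> k) A))) \<le> 0" by simp
  qed (simp_all add: N)
  also have "ln (real N) = real (card A) * ln 2" by (simp add: N ln_realpow)
  also have "\<dots> \<le> real n * ln 2" using cA by (intro mult_right_mono) auto
  finally show ?thesis by simp
qed

section \<open>Affine features and the choice of the degree\<close>

lemma feature_override:
  assumes "A \<subseteq> {..<n}"
  shows "feature n w b (override_on \<tau> \<sigma> A)
    = (\<Sum>j\<in>A. w j * \<sigma> j) + ((\<Sum>j\<in>{..<n} - A. w j * \<tau> j) + b)"
proof -
  have "(\<Sum>j<n. w j * override_on \<tau> \<sigma> A j)
      = (\<Sum>j\<in>{..<n} - A. w j * override_on \<tau> \<sigma> A j) + (\<Sum>j\<in>A. w j * override_on \<tau> \<sigma> A j)"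
    by (rule sum.subset_diff[OF assms]) simp
  also have "(\<Sum>j\<in>A. w j * override_on \<tau> \<sigma> A j) = (\<Sum>j\<in>A. w j * \<sigma> j)"
    by (intro sum.cong) auto
  also have "(\<Sum>j\<in>{..<n} - A. w j * override_on \<tau> \<sigma> A j) = (\<Sum>j\<in>{..<n} - A. w j * \<tau> j)"
    by (intro sum.cong) auto
  finally show ?thesis by (simp add: feature_def)
qed

lemma feature_abs_less:
  fixes \<mu> :: nat
  assumes "(SUP (s, i) \<in> spins {..<n} \<times> {..<\<mu>}. \<bar>feature n (w i) (b i) s\<bar>) < t_bar"
    and "s \<in> spins {..<n}" "i < \<mu>"
  shows "\<bar>feature n (w i) (b i) s\<bar> < t_bar"
proof -
  have "bdd_above ((\<lambda>(s, i). \<bar>feature n (w i) (b i) s\<bar>) ` (spins {..<n} \<times> {..<\<mu>}))"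
    by (intro bdd_above_finite finite_imageI finite_cartesian_product finite_spins) auto
  then have "(\<lambda>(s, i). \<bar>feature n (w i) (b i) s\<bar>) (s, i)
      \<le> (SUP (s, i) \<in> spins {..<n} \<times> {..<\<mu>}. \<bar>feature n (w i) (b i) s\<bar>)"
    by (intro cSUP_upper) (use assms in auto)
  then show ?thesis using assms(1) by simp
qed

text \<open>With \<open>D = m n\<close>, \<open>m \<ge> n\<close>, the interpolation error beats the factor \<open>4 ^ n\<close>
  needed for the \<open>2 ^ n\<close> amplitudes.\<close>

lemma interpolation_error_small:
  fixes B R :: real
  assumes m: "16 * B * real m ^ 4 \<le> R ^ m" "n \<le> m" and n: "1 \<le> n" and \<mu>: "\<mu> \<le> n"
    and B: "1 \<le> B" "0 \<le> B'" "B' \<le> B" and R: "R > 1"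
  shows "real \<mu> * real (m * n) ^ \<mu> * ((1 + real (m * n)) * (B' / R ^ (m * n))) \<le> 1 / 4 ^ n"
proof -
  let ?D = "real (m * n)"
  have D: "1 \<le> ?D" using m(2) n by (simp add: mult_le_one Suc_le_eq flip: of_nat_mult)
  \<comment> \<open>Every factor is padded to an n-th power, so that only the bases have to be
    compared: \<open>4 * ?D\<^sup>2 * B\<close> against \<open>R ^ m / 4\<close>. Since
    \<open>?D\<close> is at most the square of \<open>m\<close>, this is the hypothesis with its
    constant 16 and exponent 4.\<close>
  have "real \<mu> * ?D ^ \<mu> * ((1 + ?D) * B') \<le> 2 ^ n * ?D ^ n * ((2 ^ n * ?D ^ n) * B ^ n)"
  proof (intro mult_mono)
    have "\<mu> \<le> 2 ^ n" using \<mu> less_exp[of n] by linarith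
    then have "real \<mu> \<le> real (2 ^ n)" by (simp only: of_nat_le_iff)
    then show "real \<mu> \<le> 2 ^ n" by simp
    show "?D ^ \<mu> \<le> ?D ^ n" using \<mu> D by (rule power_increasing)
    have "?D ^ 1 \<le> ?D ^ n" "(2::real) ^ 1 \<le> 2 ^ n" using n D by (intro power_increasing; simp)+
    then have "2 * ?D \<le> 2 ^ n * ?D ^ n" using D by (intro mult_mono) auto
    then show "1 + ?D \<le> 2 ^ n * ?D ^ n" using D by linarith
    have "B ^ 1 \<le> B ^ n" using n B by (intro power_increasing) auto
    then show "B' \<le> B ^ n" using B by simp
  qed (use D B in auto)
  also have "\<dots> = (4 * ?D\<^sup>2 * B) ^ n"
    by (simp add: power_mult_distrib power2_eq_square mult_ac flip: power_mult_distrib)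
  also have "\<dots> \<le> (R ^ m / 4) ^ n"
  proof (intro power_mono)
    have "?D\<^sup>2 \<le> (real m * real m)\<^sup>2" unfolding of_nat_mult using m(2) by (intro power_mono mult_left_mono) auto
    then have "?D\<^sup>2 * B \<le> real m ^ 4 * B"
      using B by (intro mult_right_mono) (auto simp: power2_eq_square power4_eq_xxxx)
    then show "4 * ?D\<^sup>2 * B \<le> R ^ m / 4" using m(1) by (simp add: mult_ac)
  qed (use B in auto)
  also have "\<dots> = R ^ (m * n) / 4 ^ n" by (simp add: power_divide power_mult)
  finally have "real \<mu> * ?D ^ \<mu> * ((1 + ?D) * B') / R ^ (m * n) \<le> 1 / 4 ^ n"
    using R by (simp add: field_simps)
  then show ?thesis by (simp add: mult_ac)
qed

lemma analytic_nqs_entropy_bound: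
  assumes t: "t_bar > 0" and C: "C > 0" and a: "a_min > 0"
  shows "\<exists>c>0. \<forall>n\<ge>2. \<forall>k \<Psi> \<mu> G w b. analytic_nqs t_bar C a_min n k \<Psi> \<mu> G w b \<longrightarrow>
    (\<forall>A\<subseteq>{..<n}. entanglement_entropy n \<Psi> A \<le> c * real \<mu> * ln (real n))"
proof -
  obtain K R where KR: "K > 0" "R > 1" and approx:
    "\<forall>C \<mu> g X D. bounded_bernstein_extension C a_min \<mu> g \<longrightarrow> D \<ge> 1 \<longrightarrow> C \<ge> 0 \<longrightarrow>
      (\<forall>i<\<mu>. finite (X i) \<and> X i \<subseteq> {-1..1}) \<longrightarrow>
      (\<exists>\<alpha> \<beta>. \<forall>u v. (\<lambda>i\<in>{..<\<mu>}. u i + v i) \<in> Pi\<^sub>E {..<\<mu>} X \<longrightarrow>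
        cmod (g (\<lambda>i\<in>{..<\<mu>}. u i + v i) - (\<Sum>k<D ^ \<mu>. \<alpha> k u * \<beta> k v))
          \<le> real \<mu> * real D ^ \<mu> * ((1 + real D) * (K * C / R ^ D)))"
    using analytic_low_rank_approximation[OF a] by (elim exE conjE)
  \<comment> \<open>A value of at least 1 may be replaced by its n-th power in the error
    estimate.\<close>
  define K1 where "K1 = max 1 (K * C)"
  have "\<forall>\<^sub>F m in sequentially. 16 * K1 * real m ^ 4 \<le> R ^ m" using KR(2) by real_asymp
  then obtain D0' where D0': "\<And>m. m \<ge> D0' \<Longrightarrow> 16 * K1 * real m ^ 4 \<le> R ^ m"
    by (auto simp: eventually_sequentially)
  define D0 where "D0 = max 1 D0'"
  have D0: "1 \<le> D0" "\<And>m. m \<ge> D0 \<Longrightarrow> 16 * K1 * real m ^ 4 \<le> R ^ m" using D0' by (auto simp: D0_def)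
  \<comment> \<open>From \<open>ln D = ln D0 + 2 * ln n\<close>: the summand 2 is the quadratic
    growth of the degree, and the constants \<open>ln D0\<close> and 3 are absorbed using
    \<open>\<mu> \<ge> 1\<close> and \<open>ln n \<ge> ln 2\<close>.\<close>
  define c where "c = 2 + (ln (real D0) + 3) / ln 2"
  have lD0: "ln (real D0) \<ge> 0" using D0(1) by simp
  have c: "c > 0" using lD0 by (auto simp: c_def intro: add_pos_nonneg)
  have "entanglement_entropy n \<Psi> A \<le> c * real \<mu> * ln (real n)"
    if n: "n \<ge> 2" and nqs: "analytic_nqs t_bar C a_min n k \<Psi> \<mu> G w b" and A: "A \<subseteq> {..<n}"
    for n k \<Psi> \<mu> G w b A
  proof -
    note unfolded = nqs[unfolded analytic_nqs_def]
    have norm: "normalized_state n \<Psi>" using unfolded by (elim conjE)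
    have \<mu>: "1 \<le> \<mu>" using unfolded by (elim conjE)
    have \<Psi>: "\<forall>s\<in>spins {..<n}. \<Psi> s = G (\<lambda>i\<in>{..<\<mu>}. feature n (w i) (b i) s)"
      using unfolded by (elim conjE)
    have sup: "(SUP (s, i) \<in> spins {..<n} \<times> {..<\<mu>}. \<bar>feature n (w i) (b i) s\<bar>) < t_bar"
      using unfolded by (elim conjE)
    have ext: "bounded_bernstein_extension C a_min \<mu> (\<lambda>x. G (\<lambda>i\<in>{..<\<mu>}. t_bar * x i))"
      using unfolded by (elim conjE)
    have ln2: "ln 2 \<le> ln (real n)" using n by simp
    have le1: "1 * 1 \<le> real \<mu> * (ln (real n) / ln 2)"
      using \<mu> ln2 by (intro mult_mono) auto
    have one: "x \<le> (x / ln 2) * (real \<mu> * ln (real n))" if "x \<ge> 0" for x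
      using mult_left_mono[OF le1 that] by simp
    show ?thesis
    proof (cases "\<mu> \<le> n")
      case False
      have "entanglement_entropy n \<Psi> A \<le> real n * ln 2 + 3"
        by (rule entanglement_entropy_trivial_bound[OF norm A])
      also have "real n * ln 2 \<le> real \<mu> * ln (real n)" using False ln2 by (intro mult_mono) auto
      also have "real \<mu> * ln (real n) + 3 \<le> real \<mu> * ln (real n) + (3 / ln 2) * (real \<mu> * ln (real n))"
        using one[of 3] by simp
      also have "\<dots> = (1 + 3 / ln 2) * (real \<mu> * ln (real n))" by (simp add: algebra_simps)
      also have "\<dots> \<le> c * (real \<mu> * ln (real n))"
      proof (rule mult_right_mono)
        have "0 \<le> ln (real D0) / ln 2" using lD0 by simp
        then show "1 + 3 / ln 2 \<le> c" unfolding c_def add_divide_distrib by linarith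
      qed (use n in simp)
      finally show ?thesis by (simp add: mult_ac)
    next
      case True
      \<comment> \<open>As a multiple of both, \<open>m\<close> is at least \<open>D0\<close>, where
        the exponential has overtaken the fourth power, and at least \<open>n\<close>, so that
        \<open>D\<close> is bounded by the square of \<open>m\<close>.\<close>
      define m where "m = D0 * n"
      define D where "D = m * n"
      have m: "D0 \<le> m" "n \<le> m" using D0(1) n by (auto simp: m_def)
      have D1: "1 \<le> D" using D0(1) n by (simp add: D_def m_def)
      \<comment> \<open>The grid of candidate nodes: all rescaled values of the feature on spin
        configurations. They lie in [-1, 1] by the bound on the features.\<close>
      define X where "X i = (\<lambda>s. feature n (w i) (b i) s / t_bar) ` spins {..<n}" for i
      have X: "finite (X i) \<and> X i \<subseteq> {-1..1}" if "i < \<mu>" for i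
      proof -
        have "\<bar>feature n (w i) (b i) s / t_bar\<bar> \<le> 1" if "s \<in> spins {..<n}" for s
          using feature_abs_less[OF sup that \<open>i < \<mu>\<close>] t by (simp add: abs_divide)
        then have "feature n (w i) (b i) s / t_bar \<in> {-1..1}" if "s \<in> spins {..<n}" for s
          using that by (simp only: abs_le_iff atLeastAtMost_iff minus_le_iff)
        then show ?thesis unfolding X_def by (intro conjI finite_imageI finite_spins image_subsetI) auto
      qed
      define u v where "u \<sigma> i = (\<Sum>j\<in>A. w i j * \<sigma> j) / t_bar"
        and "v \<tau> i = ((\<Sum>j\<in>{..<n} - A. w i j * \<tau> j) + b i) / t_bar" for \<sigma> \<tau> :: "nat \<Rightarrow> real" and i
      have uv: "u \<sigma> i + v \<tau> i = feature n (w i) (b i) (override_on \<tau> \<sigma> A) / t_bar" for \<sigma> \<tau> i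
        unfolding feature_override[OF A] u_def v_def by (simp add: add_divide_distrib)
      have "\<exists>\<alpha> \<beta>. \<forall>u v. (\<lambda>i\<in>{..<\<mu>}. u i + v i) \<in> Pi\<^sub>E {..<\<mu>} X \<longrightarrow>
        cmod (G (\<lambda>i\<in>{..<\<mu>}. t_bar * (\<lambda>i\<in>{..<\<mu>}. u i + v i) i) - (\<Sum>k<D ^ \<mu>. \<alpha> k u * \<beta> k v))
          \<le> real \<mu> * real D ^ \<mu> * ((1 + real D) * (K * C / R ^ D))"
        by (rule approx[rule_format, OF ext D1 less_imp_le[OF C]]) (rule X)
      then obtain \<alpha> \<beta> where \<alpha>\<beta>: "\<forall>u v. (\<lambda>i\<in>{..<\<mu>}. u i + v i) \<in> Pi\<^sub>E {..<\<mu>} X \<longrightarrow>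
        cmod (G (\<lambda>i\<in>{..<\<mu>}. t_bar * (\<lambda>i\<in>{..<\<mu>}. u i + v i) i) - (\<Sum>k<D ^ \<mu>. \<alpha> k u * \<beta> k v))
          \<le> real \<mu> * real D ^ \<mu> * ((1 + real D) * (K * C / R ^ D))"
        by (elim exE)
      have "entanglement_entropy n \<Psi> A \<le> ln (real (D ^ \<mu>)) + 3"
      proof (rule entanglement_entropy_low_rank[OF norm A])
        show "1 \<le> D ^ \<mu>" using D1 by simp
        show "real \<mu> * real D ^ \<mu> * ((1 + real D) * (K * C / R ^ D)) \<le> 1 / 4 ^ n"
          unfolding D_def
          by (rule interpolation_error_small[OF D0(2)[OF m(1)] m(2) _ True _ _ _ KR(2)])
            (use n KR(1) C in \<open>simp_all add: K1_def\<close>)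
        show "0 \<le> real \<mu> * real D ^ \<mu> * ((1 + real D) * (K * C / R ^ D))" using KR C by simp
        fix \<sigma> \<tau> assume "\<sigma> \<in> spins A" "\<tau> \<in> spins ({..<n} - A)"
        then have s: "override_on \<tau> \<sigma> A \<in> spins {..<n}"
          using A by (auto simp: spins_def PiE_iff extensional_def override_on_def)
        have "(\<lambda>i\<in>{..<\<mu>}. u \<sigma> i + v \<tau> i) \<in> Pi\<^sub>E {..<\<mu>} X" using s by (auto simp: uv X_def)
        note \<alpha>\<beta>[rule_format, OF this]
        moreover have "(\<lambda>i\<in>{..<\<mu>}. t_bar * (\<lambda>i\<in>{..<\<mu>}. u \<sigma> i + v \<tau> i) i)
            = (\<lambda>i\<in>{..<\<mu>}. feature n (w i) (b i) (override_on \<tau> \<sigma> A))"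
          using t by (auto simp: uv)
        ultimately show "cmod (\<Psi> (override_on \<tau> \<sigma> A) - (\<Sum>k<D ^ \<mu>. \<alpha> k (u \<sigma>) * \<beta> k (v \<tau>)))
            \<le> real \<mu> * real D ^ \<mu> * ((1 + real D) * (K * C / R ^ D))"
          using bspec[OF \<Psi> s] by simp
      qed
      also have "ln (real (D ^ \<mu>)) = real \<mu> * (ln (real D0) + 2 * ln (real n))"
      proof -
        have "ln (real D) = ln (real D0 * (real n * real n))" by (simp add: D_def m_def mult_ac)
        also have "\<dots> = ln (real D0) + 2 * ln (real n)"
          using D0(1) n by (simp add: ln_mult)
        finally show ?thesis using D1 by (simp add: ln_realpow)
      qed
      also have "\<dots> + 3 \<le> real \<mu> * (ln (real D0) / ln 2 * ln (real n) + 2 * ln (real n)) + 3 / ln 2 * (real \<mu> * ln (real n))"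
      proof (intro add_mono mult_left_mono one)
        have "ln (real D0) * ln 2 \<le> ln (real D0) * ln (real n)" using ln2 lD0 by (rule mult_left_mono)
        then show "ln (real D0) \<le> ln (real D0) / ln 2 * ln (real n)" by (simp add: le_divide_eq)
      qed auto
      also have "\<dots> = c * real \<mu> * ln (real n)" by (simp add: c_def add_divide_distrib algebra_simps)
      finally show ?thesis .
    qed
  qed
  then have "\<forall>n\<ge>2. \<forall>k \<Psi> \<mu> G w b. analytic_nqs t_bar C a_min n k \<Psi> \<mu> G w b \<longrightarrow>
      (\<forall>A\<subseteq>{..<n}. entanglement_entropy n \<Psi> A \<le> c * real \<mu> * ln (real n))"
    by (intro allI impI)
  with c show ?thesis by (intro exI[of _ c] conjI)
qed

theorem theorem4:
  fixes t_bar C a_min :: real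
  assumes "t_bar > 0" and "C > 0" and "a_min > 0"
  shows "(\<exists>c>0. \<exists>c'>0. \<forall>n\<ge>2. \<forall>k\<ge>1. \<forall>\<Psi> \<mu> G w b.
            analytic_nqs t_bar C a_min n k \<Psi> \<mu> G w b \<longrightarrow>
            (\<forall>A\<subseteq>{..<n}.
               entanglement_entropy n \<Psi> A \<le> c * real \<mu> * ln (real n) \<and>
               entanglement_entropy n \<Psi> A \<le> c' * real k * ln (real n)))
       \<and> (\<forall>k \<Psi> \<mu> G w b.
            (\<forall>\<^sub>F n in sequentially.
               k n \<ge> 1 \<and> analytic_nqs t_bar C a_min n (k n) (\<Psi> n) (\<mu> n) (G n) (w n) (b n)) \<and>
            (\<lambda>n. real (k n)) \<in> O(\<lambda>_. 1) \<longrightarrow>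
            \<not> volume_law \<Psi>)"
proof -
  obtain c where c: "c > 0" and all_bounds:
    "\<forall>n\<ge>2. \<forall>k \<Psi> \<mu> G w b. analytic_nqs t_bar C a_min n k \<Psi> \<mu> G w b \<longrightarrow>
       (\<forall>A\<subseteq>{..<n}. entanglement_entropy n \<Psi> A \<le> c * real \<mu> * ln (real n))"
    using analytic_nqs_entropy_bound[OF assms] by (elim exE conjE)
  have mu_bound: "entanglement_entropy n \<Psi> A \<le> c * real \<mu> * ln (real n)"
    if "n \<ge> 2" "analytic_nqs t_bar C a_min n k \<Psi> \<mu> G w b" "A \<subseteq> {..<n}" for n k \<Psi> \<mu> G w b A
    by (rule all_bounds[rule_format, OF that])
  have k_bound: "entanglement_entropy n \<Psi> A \<le> (2 * c) * real k * ln (real n)"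
    if "n \<ge> 2" "k \<ge> 1" "analytic_nqs t_bar C a_min n k \<Psi> \<mu> G w b" "A \<subseteq> {..<n}"
    for n k \<Psi> \<mu> G w b A
  proof -
    \<comment> \<open>\<open>\<mu> \<le> k + 1 \<le> 2 * k\<close> because \<open>k \<ge> 1\<close>;
      this doubles the constant.\<close>
    have "\<mu> \<le> 2 * k" using that(2,3) unfolding analytic_nqs_def by linarith
    then have "c * real \<mu> * ln (real n) \<le> c * real (2 * k) * ln (real n)"
      using c that(1) by (intro mult_right_mono mult_left_mono) auto
    then show ?thesis using mu_bound[OF that(1,3,4)] by simp
  qed
  have "\<not> volume_law \<Psi>"
    if nqs: "\<forall>\<^sub>F n in sequentially.
        k n \<ge> 1 \<and> analytic_nqs t_bar C a_min n (k n) (\<Psi> n) (\<mu> n) (G n) (w n) (b n)"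
      and k: "(\<lambda>n. real (k n)) \<in> O(\<lambda>_. 1)" for k \<Psi> \<mu> G w b
  proof
    assume "volume_law \<Psi>"
    then obtain A \<kappa> where A: "\<kappa> > 0" "\<And>n. A n \<subseteq> {..<n}"
      "(\<lambda>n. real (card (A n))) \<in> \<Theta>(\<lambda>n. real n)"
      "\<forall>\<^sub>F n in sequentially. entanglement_entropy n (\<Psi> n) (A n) \<ge> \<kappa> * real (card (A n))"
      unfolding volume_law_def by blast
    have "(\<lambda>n. real (card (A n))) \<in> \<Omega>(\<lambda>n. real n)" using A(3) by (rule bigthetaD2)
    then obtain c1 where c1: "c1 > 0"
      "\<forall>\<^sub>F n in sequentially. norm (real (card (A n))) \<ge> c1 * norm (real n)"
      by (rule landau_omega.bigE)
    obtain c2 where c2: "c2 > 0" "\<forall>\<^sub>F n in sequentially. norm (real (k n)) \<le> c2 * norm (1::real)"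
      using k by (rule landau_o.bigE)
    \<comment> \<open>A volume law would force linear growth at rate \<open>\<kappa> * c1\<close>,
      while bounded \<open>k\<close> allows only logarithmic growth with factor
      \<open>2 * c * c2\<close>.\<close>
    have "\<forall>\<^sub>F n in sequentially. (2 * c * c2) * ln (real n) < (\<kappa> * c1) * real n"
      using mult_pos_pos[OF A(1) c1(1)] by real_asymp
    with nqs A(4) c1(2) c2(2) eventually_ge_at_top[of 2] have "\<forall>\<^sub>F n in sequentially. False"
    proof eventually_elim
      case (elim n)
      have "(\<kappa> * c1) * real n \<le> \<kappa> * real (card (A n))" using elim A(1) by (simp add: mult.assoc)
      also have "\<dots> \<le> entanglement_entropy n (\<Psi> n) (A n)" using elim by simp
      also have "\<dots> \<le> (2 * c) * real (k n) * ln (real n)"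
        by (rule k_bound) (use elim A(2) in auto)
      also have "\<dots> \<le> (2 * c) * c2 * ln (real n)"
        using elim c by (intro mult_right_mono mult_left_mono) auto
      finally show False using elim by simp
    qed
    then show False by simp
  qed
  then have volume: "\<forall>k \<Psi> \<mu> G w b.
      (\<forall>\<^sub>F n in sequentially.
         k n \<ge> 1 \<and> analytic_nqs t_bar C a_min n (k n) (\<Psi> n) (\<mu> n) (G n) (w n) (b n)) \<and>
      (\<lambda>n. real (k n)) \<in> O(\<lambda>_. 1) \<longrightarrow> \<not> volume_law \<Psi>"
    by (intro allI impI) (elim conjE)
  have "\<forall>n\<ge>2. \<forall>k\<ge>1. \<forall>\<Psi> \<mu> G w b. analytic_nqs t_bar C a_min n k \<Psi> \<mu> G w b \<longrightarrow>
      (\<forall>A\<subseteq>{..<n}. entanglement_entropy n \<Psi> A \<le> c * real \<mu> * ln (real n) \<and>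
         entanglement_entropy n \<Psi> A \<le> (2 * c) * real k * ln (real n))"
    by (intro allI impI conjI; (rule mu_bound | rule k_bound); assumption)
  then have ex: "\<exists>c'>0. \<forall>n\<ge>2. \<forall>k\<ge>1. \<forall>\<Psi> \<mu> G w b. analytic_nqs t_bar C a_min n k \<Psi> \<mu> G w b \<longrightarrow>
      (\<forall>A\<subseteq>{..<n}. entanglement_entropy n \<Psi> A \<le> c * real \<mu> * ln (real n) \<and>
         entanglement_entropy n \<Psi> A \<le> c' * real k * ln (real n))"
    using c by (intro exI[of _ "2 * c"] conjI) auto
  show ?thesis by (rule conjI[OF _ volume], rule exI[of _ c], rule conjI[OF c]) (fact ex)
qed

end
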